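(* Let $\mathcal{D}$ be a set, let $V_0$ be the subspace of $\mathit{UCP}(\mathcal{D})$ spanned by the one-vertex trees $\tau_{(0,d)}$, $d\in\mathcal{D}$, and let $f:V_0\longrightarrow V_0$ be any linear map. Let $I_f$ be the Com-PreLie ideal of $\mathit{UCP}(\mathcal{D})$ generated by the elements $\tau_{(1,d)}-f(\tau_{(0,d)})$, $d\in\mathcal{D}$. Then: 1. Let $\mathcal{UPT}'(\mathcal{D})$ be the set of trees $T\in\mathcal{UPT}(\mathcal{D})$ such that the decoration of every vertex of $T$ is of the form $(0,d)$ with $d\in\mathcal{D}$ (so $\mathcal{UPT}'(\mathcal{D})$ is identified with the set $\mathcal{PT}(\mathcal{D})$ of partitioned trees decorated by $\mathcal{D}$). The family $(T+I_f)_{T\in\mathcal{UPT}'(\mathcal{D})}$ is a basis of $\mathit{UCP}(\mathcal{D})/I_f$. 2. In $\mathit{UCP}(\mathcal{D})/I_f$, for any $d\in\mathcal{D}$, $\tau_{(0,d)}\bullet\emptyset=f(\tau_{(0,d)})$.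
   Context: $\mathbb{K}$ is a field of characteristic zero. A Com-PreLie algebra is a vector space $A$ with bilinear products $\cdot,\bullet$ such that $\cdot$ is associative and commutative, $(a\bullet b)\bullet c-a\bullet(b\bullet c)=(a\bullet c)\bullet b-a\bullet(c\bullet b)$ and $(a\cdot b)\bullet c=(a\bullet c)\cdot b+a\cdot(b\bullet c)$ for all $a,b,c$. A Com-PreLie ideal is a subspace $I$ with $I\cdot A\subseteq I$, $I\bullet A\subseteq I$ and $A\bullet I\subseteq I$. A partitioned forest is a (finite) rooted forest $F$ with vertex set $V(F)$, edges oriented from the roots to the leaves, together with a partition of $V(F)$ into blocks such that two vertices in the same block are either both roots or have the same parent. It is a partitioned tree if all its roots lie in one block; the empty forest $\emptyset$ is a partitioned tree. $\mathcal{UPT}(\mathcal{D})$ is the set of isomorphism classes of partitioned trees (including $\emptyset$) with vertices decorated by elements of $\mathbb{N}\times\mathcal{D}$, $\mathbb{N}=\{0,1,2,\ldots\}$. $\tau_{(k,d)}$ is the one-vertex tree decorated by $(k,d)$. $T\cdot T'$ is the disjoint union of $T$ and $T'$ with their two blocks of roots merged into one block (unit $\emptyset$). For a vertex $s$ of $T$ and $T'\ne\emptyset$, $T\bullet_{s,*}T'$ is obtained by adding edges from $s$ to every root of $T'$, keeping all blocks of $T$ and $T'$ unchanged. $T[+1]_s$ is $T$ with the decoration $(i,d)$ of $s$ replaced by $(i+1,d)$. $\mathit{UCP}(\mathcal{D})$ is the unitary Com-PreLie algebra with basis $\mathcal{UPT}(\mathcal{D})$, product $\cdot$, and $T\bullet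 T'=\sum_{s\in V(T)}T\bullet_{s,*}T'$ if $T'\neq\emptyset$, $T\bullet\emptyset=\sum_{s\in V(T)}T[+1]_s$. *)

theory Defs
  imports
    "HOL-Algebra.Module"
    "HOL-Algebra.QuotRing"
    "HOL-Library.Disjoint_Sets"
    "HOL-Library.Poly_Mapping"
begin

section \<open>Partitioned forests and partitioned trees\<close>

text \<open>Edges are pairs (parent, child). The value of \<open>deco\<close> outside \<open>verts\<close> is irrelevant.\<close>

record ('v, 'c) pforest =
  verts :: "'v set"
  edges :: "('v \<times> 'v) set"
  blocks :: "'v set set"
  deco :: "'v \<Rightarrow> 'c"

definition roots :: "('v, 'c) pforest \<Rightarrow> 'v set" where
  "roots F = {x \<in> verts F. \<forall>u. (u, x) \<notin> edges F}"

definition rooted_forest :: "('v, 'c) pforest \<Rightarrow> bool" where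
  "rooted_forest F \<longleftrightarrow>
     finite (verts F) \<and> edges F \<subseteq> verts F \<times> verts F \<and> acyclic (edges F) \<and>
     (\<forall>u w x. (u, x) \<in> edges F \<and> (w, x) \<in> edges F \<longrightarrow> u = w)"

definition partitioned_forest :: "('v, 'c) pforest \<Rightarrow> bool" where
  "partitioned_forest F \<longleftrightarrow>
     rooted_forest F \<and> partition_on (verts F) (blocks F) \<and>
     (\<forall>B\<in>blocks F. \<forall>x\<in>B. \<forall>y\<in>B.
        (x \<in> roots F \<and> y \<in> roots F) \<or> (\<exists>u. (u, x) \<in> edges F \<and> (u, y) \<in> edges F))"

definition partitioned_tree :: "('v, 'c) pforest \<Rightarrow> bool" where
  "partitioned_tree F \<longleftrightarrow>
     partitioned_forest F \<and> (verts F = {} \<or> (\<exists>B\<in>blocks F. roots F \<subseteq> B))"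

definition pforest_iso :: "('v, 'c) pforest \<Rightarrow> ('w, 'c) pforest \<Rightarrow> bool" where
  "pforest_iso F G \<longleftrightarrow>
     (\<exists>h. bij_betw h (verts F) (verts G) \<and>
          edges G = map_prod h h ` edges F \<and>
          blocks G = (`) h ` blocks F \<and>
          (\<forall>x\<in>verts F. deco G (h x) = deco F x))"

text \<open>
  Every finite forest is isomorphic to one whose vertices are natural numbers. The isomorphism
  class of a forest, on whatever vertex type, is represented by the set of its copies on
  natural numbers.
\<close>

type_synonym 'c ptree_class = "(nat, 'c) pforest set"

definition iso_class :: "('v, 'c) pforest \<Rightarrow> 'c ptree_class" where
  "iso_class F = {G. pforest_iso F G}"

definition rep :: "'c ptree_class \<Rightarrow> (nat, 'c) pforest" where
  "rep X = (SOME F. F \<in> X)"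

definition UPT :: "'d set \<Rightarrow> (nat \<times> 'd) ptree_class set" where
  "UPT D = {iso_class F | F :: (nat, nat \<times> 'd) pforest.
     partitioned_tree F \<and> (\<forall>s\<in>verts F. deco F s \<in> UNIV \<times> D)}"

definition UPT' :: "'d set \<Rightarrow> (nat \<times> 'd) ptree_class set" where
  "UPT' D = {iso_class F | F :: (nat, nat \<times> 'd) pforest.
     partitioned_tree F \<and> (\<forall>s\<in>verts F. deco F s \<in> {0} \<times> D)}"

definition empty_forest :: "(unit, 'c) pforest" where
  "empty_forest = \<lparr>verts = {}, edges = {}, blocks = {}, deco = (\<lambda>_. undefined)\<rparr>"

definition one_vertex :: "'c \<Rightarrow> (unit, 'c) pforest" where
  "one_vertex c = \<lparr>verts = {()}, edges = {}, blocks = {{()}}, deco = (\<lambda>_. c)\<rparr>"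

text \<open>
  In the following two operations the vertex set is the disjoint union of those of \<open>F\<close> and \<open>G\<close>.
  For partitioned trees, \<open>roots F\<close> and \<open>roots G\<close> are the two blocks of roots, or are empty; an
  empty merged block is discarded.
\<close>

definition merge :: "('v, 'c) pforest \<Rightarrow> ('w, 'c) pforest \<Rightarrow> ('v + 'w, 'c) pforest" where
  "merge F G =
     \<lparr>verts = Inl ` verts F \<union> Inr ` verts G,
      edges = map_prod Inl Inl ` edges F \<union> map_prod Inr Inr ` edges G,
      blocks = (`) Inl ` (blocks F - {roots F}) \<union> (`) Inr ` (blocks G - {roots G})
               \<union> ({Inl ` roots F \<union> Inr ` roots G} - {{}}),
      deco = case_sum (deco F) (deco G)\<rparr>"

definition graft :: "('v, 'c) pforest \<Rightarrow> 'v \<Rightarrow> ('w, 'c) pforest \<Rightarrow> ('v + 'w, 'c) pforest" where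
  "graft F s G =
     \<lparr>verts = Inl ` verts F \<union> Inr ` verts G,
      edges = map_prod Inl Inl ` edges F \<union> map_prod Inr Inr ` edges G
              \<union> {(Inl s, Inr r) | r. r \<in> roots G},
      blocks = (`) Inl ` blocks F \<union> (`) Inr ` blocks G,
      deco = case_sum (deco F) (deco G)\<rparr>"

definition raise :: "('v, nat \<times> 'd) pforest \<Rightarrow> 'v \<Rightarrow> ('v, nat \<times> 'd) pforest" where
  "raise F s = F\<lparr>deco := (deco F)(s := apfst Suc (deco F s))\<rparr>"


section \<open>Com-PreLie ideals and quotients\<close>

text \<open>
  The associative commutative product is the \<open>mult\<close> field of the record, the pre-Lie product
  is \<open>bullet\<close>; \<open>one\<close> is the unit of \<open>mult\<close>. Only the operations matter for the notions below.
\<close>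

record ('k, 'a) com_prelie = "('k, 'a) module" +
  bullet :: "'a \<Rightarrow> 'a \<Rightarrow> 'a" (infixl "\<bullet>\<index>" 70)

definition subspace_span ::
  "('k, 'm) ring_scheme \<Rightarrow> ('k, 'a, 'n) module_scheme \<Rightarrow> 'a set \<Rightarrow> 'a set" where
  "subspace_span K A S = \<Inter>{V. submodule V K A \<and> S \<subseteq> V}"

definition linear_endo_on ::
  "('k, 'm) ring_scheme \<Rightarrow> ('k, 'a, 'n) module_scheme \<Rightarrow> 'a set \<Rightarrow> ('a \<Rightarrow> 'a) \<Rightarrow> bool" where
  "linear_endo_on K A V f \<longleftrightarrow>
     f \<in> V \<rightarrow> V \<and>
     (\<forall>x\<in>V. \<forall>y\<in>V. f (x \<oplus>\<^bsub>A\<^esub> y) = f x \<oplus>\<^bsub>A\<^esub> f y) \<and>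
     (\<forall>c\<in>carrier K. \<forall>x\<in>V. f (c \<odot>\<^bsub>A\<^esub> x) = c \<odot>\<^bsub>A\<^esub> f x)"

definition family_basis ::
  "('k, 'm) ring_scheme \<Rightarrow> ('k, 'a, 'n) module_scheme \<Rightarrow> 'j set \<Rightarrow> ('j \<Rightarrow> 'a) \<Rightarrow> bool" where
  "family_basis K A J b \<longleftrightarrow>
     b \<in> J \<rightarrow> carrier A \<and>
     (\<forall>F c. finite F \<and> F \<subseteq> J \<and> c \<in> F \<rightarrow> carrier K \<and>
        (\<Oplus>\<^bsub>A\<^esub>j\<in>F. c j \<odot>\<^bsub>A\<^esub> b j) = \<zero>\<^bsub>A\<^esub> \<longrightarrow> (\<forall>j\<in>F. c j = \<zero>\<^bsub>K\<^esub>)) \<and>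
     (\<forall>x\<in>carrier A. \<exists>F c. finite F \<and> F \<subseteq> J \<and> c \<in> F \<rightarrow> carrier K \<and>
        x = (\<Oplus>\<^bsub>A\<^esub>j\<in>F. c j \<odot>\<^bsub>A\<^esub> b j))"

definition com_prelie_ideal ::
  "('k, 'm) ring_scheme \<Rightarrow> ('k, 'a, 'n) com_prelie_scheme \<Rightarrow> 'a set \<Rightarrow> bool" where
  "com_prelie_ideal K A I \<longleftrightarrow>
     submodule I K A \<and>
     (\<forall>x\<in>I. \<forall>a\<in>carrier A. x \<otimes>\<^bsub>A\<^esub> a \<in> I \<and> x \<bullet>\<^bsub>A\<^esub> a \<in> I \<and> a \<bullet>\<^bsub>A\<^esub> x \<in> I)"

definition com_prelie_ideal_gen ::
  "('k, 'm) ring_scheme \<Rightarrow> ('k, 'a, 'n) com_prelie_scheme \<Rightarrow> 'a set \<Rightarrow> 'a set" where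
  "com_prelie_ideal_gen K A S = \<Inter>{I. com_prelie_ideal K A I \<and> S \<subseteq> I}"

text \<open>The analogue of \<open>FactRing\<close>: elements are the cosets \<open>I +>\<^bsub>A\<^esub> x\<close>.\<close>

definition com_prelie_quot ::
  "('k, 'a, 'n) com_prelie_scheme \<Rightarrow> 'a set \<Rightarrow> ('k, 'a set) com_prelie" where
  "com_prelie_quot A I =
     \<lparr>carrier = a_rcosets\<^bsub>A\<^esub> I,
      mult = rcoset_mult A I,
      one = I +>\<^bsub>A\<^esub> \<one>\<^bsub>A\<^esub>,
      zero = I,
      add = set_add A,
      smult = (\<lambda>c X. \<Union>x\<in>X. I +>\<^bsub>A\<^esub> (c \<odot>\<^bsub>A\<^esub> x)),
      bullet = (\<lambda>X Y. \<Union>x\<in>X. \<Union>y\<in>Y. I +>\<^bsub>A\<^esub> (x \<bullet>\<^bsub>A\<^esub> y))\<rparr>"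


section \<open>The algebra UCP(D)\<close>

definition base_field :: "'k::field ring" where
  "base_field = \<lparr>carrier = UNIV, mult = (*), one = 1, zero = 0, add = (+)\<rparr>"

type_synonym ('d, 'k) ucp = "(nat \<times> 'd) ptree_class \<Rightarrow>\<^sub>0 'k"

abbreviation bas :: "'t \<Rightarrow> ('t \<Rightarrow>\<^sub>0 'k::field)" where
  "bas T \<equiv> Poly_Mapping.single T 1"

abbreviation scal :: "'k::field \<Rightarrow> ('t \<Rightarrow>\<^sub>0 'k) \<Rightarrow> ('t \<Rightarrow>\<^sub>0 'k)" where
  "scal c p \<equiv> Poly_Mapping.map ((*) c) p"

definition bilinear_ext ::
  "('t \<Rightarrow> 't \<Rightarrow> ('t \<Rightarrow>\<^sub>0 'k)) \<Rightarrow> ('t \<Rightarrow>\<^sub>0 'k::field) \<Rightarrow> ('t \<Rightarrow>\<^sub>0 'k) \<Rightarrow> ('t \<Rightarrow>\<^sub>0 'k)" where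
  "bilinear_ext g p q =
     (\<Sum>S\<in>Poly_Mapping.keys p. \<Sum>T\<in>Poly_Mapping.keys q.
        scal (Poly_Mapping.lookup p S * Poly_Mapping.lookup q T) (g S T))"

text \<open>
  The products of basis elements are computed on representatives; since \<open>merge\<close>, \<open>graft\<close> and
  \<open>raise\<close> are compatible with isomorphisms of partitioned trees, the choice made by \<open>rep\<close> is
  immaterial.
\<close>

definition basis_mult ::
  "(nat \<times> 'd) ptree_class \<Rightarrow> (nat \<times> 'd) ptree_class \<Rightarrow> ('d, 'k::field) ucp" where
  "basis_mult S T = bas (iso_class (merge (rep S) (rep T)))"

definition basis_bullet ::
  "(nat \<times> 'd) ptree_class \<Rightarrow> (nat \<times> 'd) ptree_class \<Rightarrow> ('d, 'k::field) ucp" where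
  "basis_bullet S T =
     (if T = iso_class empty_forest
      then (\<Sum>s\<in>verts (rep S). bas (iso_class (raise (rep S) s)))
      else (\<Sum>s\<in>verts (rep S). bas (iso_class (graft (rep S) s (rep T)))))"

definition UCP :: "'d set \<Rightarrow> ('k::field, ('d, 'k) ucp) com_prelie" where
  "UCP D =
     \<lparr>carrier = {p. Poly_Mapping.keys p \<subseteq> UPT D},
      mult = bilinear_ext basis_mult,
      one = bas (iso_class empty_forest),
      zero = 0,
      add = (+),
      smult = scal,
      bullet = bilinear_ext basis_bullet\<rparr>"

definition tau :: "nat \<Rightarrow> 'd \<Rightarrow> ('d, 'k::field) ucp" where
  "tau k d = bas (iso_class (one_vertex (k, d)))"

definition V0 :: "'d set \<Rightarrow> ('d, 'k::field) ucp set" where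
  "V0 D = subspace_span base_field (UCP D) {tau 0 d | d. d \<in> D}"

definition I_f :: "'d set \<Rightarrow> (('d, 'k::field) ucp \<Rightarrow> ('d, 'k) ucp) \<Rightarrow> ('d, 'k) ucp set" where
  "I_f D f = com_prelie_ideal_gen base_field (UCP D) {tau 1 d - f (tau 0 d) | d. d \<in> D}"

end

theory Submission
  imports "HOL.Vector_Spaces" Defs
begin

text \<open>
  Let \<open>J\<close> be the span of the elements obtained from a decorated tree by decorating one of its
  vertices linearly by \<open>(k + 1, d) - (k, f(d))\<close>. The formulas for the products show at once that \<open>J\<close>
  is a Com-PreLie ideal containing the generators of \<open>I\<^sub>f\<close>. Conversely \<open>J \<subseteq> I\<^sub>f\<close>, by induction on the
  number of vertices and then on the number of children of the roots: a tree with several roots is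
  a product of smaller ones; a tree with a single root \<open>r\<close> and other vertices is \<open>G \<bullet>\<^sub>r H\<close> for a block \<open>H\<close> of
  children of \<open>r\<close>, and \<open>G \<bullet> H\<close> consists of this tree and of trees whose root has fewer children;
  for a single vertex, \<open>\<bullet> \<emptyset>\<close> raises \<open>k\<close>. Modulo \<open>J\<close> each positive decoration can be lowered, so
  the trees of \<open>UPT'\<close> span the quotient. They are independent because the linear map which replaces
  every decoration \<open>(k, d)\<close> by \<open>f\<^sup>k(d)\<close> kills \<open>J\<close> and fixes them.
\<close>

section \<open>Linear extensions\<close>

text \<open>The ideal is defined as an intersection, which hides its elements; identifying it with
  an explicit span makes membership checkable in both directions. The map \<open>f\<close> enters
  through coordinate vectors \<open>a d\<close>, with
  \<open>f (tau 0 d) = lin (tau 0) (a d)\<close>, so that every substitution of f(d) into a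
  decoration is a case of the linear extension \<open>lin\<close>. The difficulty in showing that a
  relation lies in the ideal is that the bullet product grafts at all vertices at once: the graft at
  the root can be isolated only if the other summands are already known to lie there. These have the
  same number of vertices, but the roots of \<open>H\<close> are no longer children of the root;
  hence the second measure of the induction. The reduction map must be well defined on isomorphism
  classes, whose vertices carry no order. It is therefore a sum over all colourings of the vertex
  set, which an isomorphism merely reindexes. After one vertex is separated off, the vanishing of a
  relation is the identity f^(k+1)(d) = f^k(f(d)).\<close>

lemma lookup_scal [simp]: "Poly_Mapping.lookup (scal c p) x = c * Poly_Mapping.lookup p x"
  by (simp add: Poly_Mapping.map.rep_eq when_def)

global_interpretation fin: vector_space "scal :: 'k::field \<Rightarrow> ('t \<Rightarrow>\<^sub>0 'k) \<Rightarrow> ('t \<Rightarrow>\<^sub>0 'k)"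
  by unfold_locales (auto intro!: poly_mapping_eqI simp: lookup_add algebra_simps)

lemma scal_single [simp]: "scal c (Poly_Mapping.single x b) = Poly_Mapping.single x (c * b)"
  by (rule poly_mapping_eqI) (simp add: lookup_single when_def)

text \<open>The linear map determined by its values on basis elements. \<open>bilinear_ext\<close>
  is brought to this form and \<open>tree_at\<close> is an instance of it, so that substituting one
  linear combination into another is the single rule \<open>lin_lin\<close>.\<close>

definition lin :: "('a \<Rightarrow> ('b \<Rightarrow>\<^sub>0 'k)) \<Rightarrow> ('a \<Rightarrow>\<^sub>0 'k) \<Rightarrow> ('b \<Rightarrow>\<^sub>0 'k::field)" where
  "lin g p = (\<Sum>x\<in>Poly_Mapping.keys p. scal (Poly_Mapping.lookup p x) (g x))"

text \<open>Supports change under addition and scaling; a common finite superset makes the sums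
  comparable term by term.\<close>

lemma lin_superset:
  assumes "finite X" "Poly_Mapping.keys p \<subseteq> X"
  shows "lin g p = (\<Sum>x\<in>X. scal (Poly_Mapping.lookup p x) (g x))"
  unfolding lin_def using assms
  by (intro sum.mono_neutral_left) (auto simp: in_keys_iff)

lemma lin_add: "lin g (p + q) = lin g p + lin g q"
proof -
  let ?X = "Poly_Mapping.keys p \<union> Poly_Mapping.keys q"
  have "Poly_Mapping.keys (p + q) \<subseteq> ?X" by (rule Poly_Mapping.keys_add)
  then show ?thesis
    by (simp add: lin_superset[of ?X] lookup_add fin.scale_left_distrib sum.distrib)
qed

lemma lin_scal: "lin g (scal c p) = scal c (lin g p)"
proof -
  have "Poly_Mapping.keys (scal c p) \<subseteq> Poly_Mapping.keys p" by (auto simp: in_keys_iff)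
  then show ?thesis
    by (simp add: lin_superset[of "Poly_Mapping.keys p"] fin.scale_sum_right)
qed

lemma lin_single [simp]: "lin g (Poly_Mapping.single x c) = scal c (g x)"
  by (cases "c = 0") (simp_all add: lin_def)

lemma lin_0 [simp]: "lin g 0 = 0"
  by (simp add: lin_def)

lemma lin_diff: "lin g (p - q) = lin g p - lin g q"
  using lin_add[of g "p - q" q] by simp

lemma lin_sum: "lin g (\<Sum>i\<in>X. p i) = (\<Sum>i\<in>X. lin g (p i))"
  by (induction X rule: infinite_finite_induct) (simp_all add: lin_add)

lemma lin_fun_sum: "lin (\<lambda>x. \<Sum>i\<in>X. g i x) p = (\<Sum>i\<in>X. lin (g i) p)"
  unfolding lin_def fin.scale_sum_right by (rule sum.swap)

lemma lin_bas [simp]: "lin bas p = p"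
  by (rule poly_mapping_eqI) (auto simp: lin_def lookup_sum lookup_single when_def in_keys_iff)

lemma lin_lin: "lin g (lin h p) = lin (\<lambda>x. lin g (h x)) p"
  by (simp add: lin_def[of h] lin_def[of "\<lambda>x. lin g (h x)"] lin_sum lin_scal)

lemma lin_cong: "(\<And>x. x \<in> Poly_Mapping.keys p \<Longrightarrow> g x = h x) \<Longrightarrow> lin g p = lin h p"
  by (simp add: lin_def)

lemma lin_in_span: "(\<And>x. x \<in> Poly_Mapping.keys p \<Longrightarrow> g x \<in> fin.span S) \<Longrightarrow> lin g p \<in> fin.span S"
  unfolding lin_def by (intro fin.span_sum fin.span_scale)

text \<open>Turns the carrier of \<open>UCP\<close>, which is defined by supports, into a span, so
  that arguments about keys become arguments about subspaces.\<close>

lemma keys_subset_span: "Poly_Mapping.keys p \<subseteq> X \<longleftrightarrow> p \<in> fin.span (bas ` X)"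
proof
  assume "Poly_Mapping.keys p \<subseteq> X"
  then have "lin bas p \<in> fin.span (bas ` X)"
    by (intro lin_in_span fin.span_base) auto
  then show "p \<in> fin.span (bas ` X)" by simp
next
  assume "p \<in> fin.span (bas ` X)"
  then show "Poly_Mapping.keys p \<subseteq> X"
  proof (induction rule: fin.span_induct)
    case base
    show ?case
    proof (rule fin.subspaceI)
      show "0 \<in> {p. Poly_Mapping.keys p \<subseteq> X}" by simp
    next
      fix p q :: "'a \<Rightarrow>\<^sub>0 'b"
      assume "p \<in> {p. Poly_Mapping.keys p \<subseteq> X}" "q \<in> {p. Poly_Mapping.keys p \<subseteq> X}"
      then show "p + q \<in> {p. Poly_Mapping.keys p \<subseteq> X}"
        using Poly_Mapping.keys_add[of p q] by blast
    next
      fix c and p :: "'a \<Rightarrow>\<^sub>0 'b"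
      assume "p \<in> {p. Poly_Mapping.keys p \<subseteq> X}"
      moreover have "Poly_Mapping.keys (scal c p) \<subseteq> Poly_Mapping.keys p"
        by (auto simp: in_keys_iff)
      ultimately show "scal c p \<in> {p. Poly_Mapping.keys p \<subseteq> X}" by blast
    qed
  next
    case (step x)
    then show ?case by auto
  qed
qed

lemma bilinear_ext_lin: "bilinear_ext g p q = lin (\<lambda>S. lin (g S) q) p"
  by (simp add: bilinear_ext_def lin_def fin.scale_sum_right mult.commute)

text \<open>Exchanging the two sums exhibits linearity in the second argument, as
  \<open>bilinear_ext_lin\<close> does in the first.\<close>

lemma bilinear_ext_lin': "bilinear_ext g p q = lin (\<lambda>T. lin (\<lambda>S. g S T) p) q"
  unfolding bilinear_ext_def lin_def
  by (subst sum.swap) (simp add: fin.scale_sum_right mult.commute)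

lemma bilinear_ext_bas [simp]:
  "bilinear_ext g (bas S) q = lin (g S) q"
  "bilinear_ext g p (bas T) = lin (\<lambda>S. g S T) p"
  by (simp_all add: bilinear_ext_lin)

lemma bilinear_ext_add:
  "bilinear_ext g (p + p') q = bilinear_ext g p q + bilinear_ext g p' q"
  "bilinear_ext g p (q + q') = bilinear_ext g p q + bilinear_ext g p q'"
  by (simp add: bilinear_ext_lin lin_add) (simp add: bilinear_ext_lin' lin_add)

text \<open>By bilinearity, products need to be examined on generators only: the outer induction
  treats the first argument, the inner one the second with the first fixed at a generator.\<close>

lemma bilinear_ext_span:
  assumes "\<And>x y. x \<in> S \<Longrightarrow> y \<in> T \<Longrightarrow> bilinear_ext g x y \<in> fin.span U"
    and x: "x \<in> fin.span S" and y: "y \<in> fin.span T"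
  shows "bilinear_ext g x y \<in> fin.span U"
  using x
proof (induction rule: fin.span_induct_alt)
  case base
  show ?case by (simp add: bilinear_ext_lin fin.span_zero)
next
  case (step c x z)
  have "bilinear_ext g x y \<in> fin.span U"
    using y
  proof (induction rule: fin.span_induct_alt)
    case base
    show ?case by (simp add: bilinear_ext_lin' fin.span_zero)
  next
    case (step c' y z)
    then show ?case
      using assms(1)[OF \<open>x \<in> S\<close>]
      by (simp add: bilinear_ext_lin' lin_add lin_scal fin.span_add fin.span_scale)
  qed
  with step show ?case
    by (simp add: bilinear_ext_lin lin_add lin_scal fin.span_add fin.span_scale)
qed

section \<open>Isomorphisms of partitioned forests\<close>

lemma partition_on_Un:
  assumes "partition_on A P" "partition_on B Q" "A \<inter> B = {}"
  shows "partition_on (A \<union> B) (P \<union> Q)"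
proof (rule partition_onI)
  show "\<Union> (P \<union> Q) = A \<union> B" using assms by (auto simp: partition_on_def)
  show "{} \<notin> P \<union> Q" using assms by (auto simp: partition_on_def)
  fix p q assume pq: "p \<in> P \<union> Q" "q \<in> P \<union> Q" "p \<noteq> q"
  have "disjnt p q" if "p \<in> P" "q \<in> Q" for p q
    using that assms unfolding partition_on_def disjnt_def by blast
  with pq show "disjnt p q"
    using assms(1,2) by (auto simp: partition_on_def pairwise_def disjnt_sym)
qed

lemma partition_on_remove:
  assumes "partition_on A P" "p \<in> P"
  shows "partition_on (A - p) (P - {p})"
  using assms unfolding partition_on_def disjoint_def by auto

lemma partition_on_inj_image':
  assumes "partition_on A P" "inj_on f A"
  shows "partition_on (f ` A) ((`) f ` P)"
proof -
  have "{} \<notin> (`) f ` P" using assms(1) by (auto simp: partition_on_def)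
  with partition_on_inj_image[OF assms] show ?thesis by simp
qed

text \<open>Keeps the witness of \<open>pforest_iso\<close> explicit, because marked vertices have
  to be followed through isomorphisms.\<close>

definition iso_map :: "('v \<Rightarrow> 'w) \<Rightarrow> ('v, 'c) pforest \<Rightarrow> ('w, 'c) pforest \<Rightarrow> bool" where
  "iso_map h F G \<longleftrightarrow> bij_betw h (verts F) (verts G) \<and> edges G = map_prod h h ` edges F \<and>
     blocks G = (`) h ` blocks F \<and> (\<forall>x\<in>verts F. deco G (h x) = deco F x)"

lemma pforest_iso_iff: "pforest_iso F G \<longleftrightarrow> (\<exists>h. iso_map h F G)"
  by (simp add: pforest_iso_def iso_map_def)

lemma partitioned_forestD:
  assumes "partitioned_forest F"
  shows "finite (verts F)" "edges F \<subseteq> verts F \<times> verts F" "acyclic (edges F)" "wf (edges F)"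
    "(u, x) \<in> edges F \<Longrightarrow> (w, x) \<in> edges F \<Longrightarrow> u = w"
    "partition_on (verts F) (blocks F)"
    "B \<in> blocks F \<Longrightarrow> x \<in> B \<Longrightarrow> y \<in> B \<Longrightarrow>
        (x \<in> roots F \<and> y \<in> roots F) \<or> (\<exists>u. (u, x) \<in> edges F \<and> (u, y) \<in> edges F)"
    "B \<in> blocks F \<Longrightarrow> B \<subseteq> verts F" "B \<in> blocks F \<Longrightarrow> B \<noteq> {}"
proof -
  have *: "finite (verts F)" "edges F \<subseteq> verts F \<times> verts F" "acyclic (edges F)"
    using assms by (auto simp: partitioned_forest_def rooted_forest_def)
  show "finite (verts F)" "edges F \<subseteq> verts F \<times> verts F" "acyclic (edges F)" by fact+
  show "wf (edges F)" using * by (meson finite_SigmaI finite_acyclic_wf finite_subset)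
  show "(u, x) \<in> edges F \<Longrightarrow> (w, x) \<in> edges F \<Longrightarrow> u = w"
    using assms by (auto simp: partitioned_forest_def rooted_forest_def)
  show p: "partition_on (verts F) (blocks F)"
    using assms by (auto simp: partitioned_forest_def)
  show "B \<in> blocks F \<Longrightarrow> x \<in> B \<Longrightarrow> y \<in> B \<Longrightarrow>
        (x \<in> roots F \<and> y \<in> roots F) \<or> (\<exists>u. (u, x) \<in> edges F \<and> (u, y) \<in> edges F)"
    using assms by (auto simp: partitioned_forest_def)
  show "B \<in> blocks F \<Longrightarrow> B \<subseteq> verts F" "B \<in> blocks F \<Longrightarrow> B \<noteq> {}"
    using p by (auto simp: partition_on_def)
qed

text \<open>Asks for well-foundedness, which implies acyclicity and passes more easily to images and
  unions of edge relations.\<close>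

lemma partitioned_forestI:
  assumes "finite (verts F)" "edges F \<subseteq> verts F \<times> verts F" "wf (edges F)"
    "\<And>u w x. (u, x) \<in> edges F \<Longrightarrow> (w, x) \<in> edges F \<Longrightarrow> u = w"
    "partition_on (verts F) (blocks F)"
    "\<And>B x y. B \<in> blocks F \<Longrightarrow> x \<in> B \<Longrightarrow> y \<in> B \<Longrightarrow>
        (x \<in> roots F \<and> y \<in> roots F) \<or> (\<exists>u. (u, x) \<in> edges F \<and> (u, y) \<in> edges F)"
  shows "partitioned_forest F"
  unfolding partitioned_forest_def rooted_forest_def
  by (intro conjI allI ballI impI assms(1,2,5) wf_acyclic[OF assms(3)] assms(6); use assms(4) in blast)

lemma partitioned_treeD: "partitioned_tree F \<Longrightarrow> partitioned_forest F"
  by (simp add: partitioned_tree_def)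

lemma iso_map_id: "iso_map (\<lambda>x. x) F F"
  by (auto simp: iso_map_def bij_betw_def map_prod_def)

lemma iso_map_trans:
  assumes "iso_map h F G" "iso_map k G H"
  shows "iso_map (k \<circ> h) F H"
proof -
  have "map_prod k k ` map_prod h h ` edges F = map_prod (k \<circ> h) (k \<circ> h) ` edges F"
    by (simp only: image_comp map_prod_compose)
  moreover have "(`) k ` (`) h ` blocks F = (`) (k \<circ> h) ` blocks F"
    by (simp add: image_image image_comp comp_def)
  moreover have "h x \<in> verts G" if "x \<in> verts F" for x
    using assms(1) that by (auto simp: iso_map_def bij_betw_def)
  ultimately show ?thesis
    using assms bij_betw_trans[of h "verts F" "verts G" k "verts H"] by (auto simp: iso_map_def)
qed

text \<open>For a partitioned forest, edges and blocks lie inside \<open>verts F\<close>, the set on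
  which the inverse undoes \<open>h\<close>.\<close>

lemma iso_map_inv:
  assumes F: "partitioned_forest F" and h: "iso_map h F G"
  shows "iso_map (inv_into (verts F) h) G F"
proof -
  let ?k = "inv_into (verts F) h"
  have b: "bij_betw h (verts F) (verts G)" using h by (simp add: iso_map_def)
  have k: "?k (h x) = x" if "x \<in> verts F" for x
    using b that by (simp add: bij_betw_def)
  have "map_prod ?k ?k ` map_prod h h ` edges F = map_prod (\<lambda>x. x) (\<lambda>x. x) ` edges F"
    unfolding image_image using partitioned_forestD(2)[OF F] k by (intro image_cong) auto
  then have e: "edges F = map_prod ?k ?k ` edges G"
    using h by (simp add: iso_map_def map_prod_def)
  have "(`) ?k ` (`) h ` blocks F = (\<lambda>x. x) ` blocks F"
    unfolding image_image
  proof (rule image_cong)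
    fix B assume "B \<in> blocks F"
    then have "B \<subseteq> verts F" by (rule partitioned_forestD(8)[OF F])
    then show "(\<lambda>x. ?k (h x)) ` B = B" using k by (auto simp: image_iff subset_iff)
  qed simp
  moreover have "deco F (?k y) = deco G y" if y: "y \<in> verts G" for y
  proof -
    obtain x where "x \<in> verts F" "y = h x" using b y by (auto simp: bij_betw_def)
    then show ?thesis using h k by (simp add: iso_map_def)
  qed
  ultimately show ?thesis
    using e b h by (simp add: iso_map_def bij_betw_inv_into)
qed

lemma roots_subset: "roots F \<subseteq> verts F"
  by (auto simp: roots_def)

lemma iso_map_roots:
  assumes F: "partitioned_forest F" and h: "iso_map h F G"
  shows "roots G = h ` roots F"
proof -
  have i: "inj_on h (verts F)" and v: "verts G = h ` verts F"
    and e: "edges G = map_prod h h ` edges F"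
    using h by (auto simp: iso_map_def bij_betw_def)
  have "(\<exists>u. (u, h x) \<in> edges G) \<longleftrightarrow> (\<exists>u. (u, x) \<in> edges F)" if "x \<in> verts F" for x
  proof
    assume "\<exists>u. (u, h x) \<in> edges G"
    then obtain a b where ab: "(a, b) \<in> edges F" "h b = h x" by (auto simp: e)
    then have "b = x"
      using i that partitioned_forestD(2)[OF F] by (auto dest: inj_onD)
    with ab show "\<exists>u. (u, x) \<in> edges F" by auto
  qed (auto simp: e)
  then show ?thesis by (auto simp: roots_def v)
qed

lemma iso_map_partitioned_forest:
  assumes F: "partitioned_forest F" and h: "iso_map h F G"
  shows "partitioned_forest G"
proof (rule partitioned_forestI)
  note FD = partitioned_forestD[OF F]
  have i: "inj_on h (verts F)" and v: "verts G = h ` verts F"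
    and e: "edges G = map_prod h h ` edges F" and b: "blocks G = (`) h ` blocks F"
    using h by (auto simp: iso_map_def bij_betw_def)
  show "finite (verts G)" using FD(1) v by simp
  show "edges G \<subseteq> verts G \<times> verts G" using FD(2) v e by auto
  show "wf (edges G)"
    unfolding e
  proof (rule wf_map_prod_image_Dom_Ran[OF FD(4)])
    fix a b assume "a \<in> Domain (edges F)" "b \<in> Range (edges F)" "h a = h b"
    moreover from this have "a \<in> verts F" "b \<in> verts F" using FD(2) by auto
    ultimately show "a = b" using i by (auto dest: inj_onD)
  qed
  fix u w x assume "(u, x) \<in> edges G" "(w, x) \<in> edges G"
  then obtain u' x' w' x'' where *: "(u', x') \<in> edges F" "(w', x'') \<in> edges F" "u = h u'" "w = h w'"
    "h x' = h x''" by (auto simp: e)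
  then have "x' = x''" using i FD(2) by (auto dest: inj_onD)
  with * FD(5) show "u = w" by auto
next
  note FD = partitioned_forestD[OF F]
  have i: "inj_on h (verts F)" and v: "verts G = h ` verts F"
    and e: "edges G = map_prod h h ` edges F" and b: "blocks G = (`) h ` blocks F"
    using h by (auto simp: iso_map_def bij_betw_def)
  show "partition_on (verts G) (blocks G)"
    unfolding v b by (rule partition_on_inj_image'[OF FD(6) i])
  fix B x y assume "B \<in> blocks G" "x \<in> B" "y \<in> B"
  then obtain B' x' y' where *: "B' \<in> blocks F" "x' \<in> B'" "y' \<in> B'" "x = h x'" "y = h y'"
    by (auto simp: b)
  show "x \<in> roots G \<and> y \<in> roots G \<or> (\<exists>u. (u, x) \<in> edges G \<and> (u, y) \<in> edges G)"
    using FD(7)[OF *(1-3)]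
  proof
    assume "\<exists>u. (u, x') \<in> edges F \<and> (u, y') \<in> edges F"
    then obtain u where "(u, x') \<in> edges F" "(u, y') \<in> edges F" by blast
    then have "(h u, x) \<in> edges G \<and> (h u, y) \<in> edges G"
      unfolding e * by (auto intro: map_prod_imageI)
    then show ?thesis by blast
  qed (simp add: iso_map_roots[OF F h] *)
qed

lemma iso_map_partitioned_tree:
  assumes "partitioned_tree F" and h: "iso_map h F G"
  shows "partitioned_tree G"
  using assms iso_map_partitioned_forest[OF _ h] iso_map_roots[OF _ h] h
  by (fastforce simp: partitioned_tree_def iso_map_def bij_betw_def)

lemma iso_class_eqI:
  assumes F: "partitioned_forest F" and h: "iso_map h F G"
  shows "iso_class F = iso_class G"
  using iso_map_trans[OF h] iso_map_trans[OF iso_map_inv[OF F h]]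
  unfolding iso_class_def pforest_iso_iff by blast

lemma ex_iso_map_nat:
  fixes F :: "('v, 'c) pforest"
  assumes F: "partitioned_forest F"
  obtains h and G :: "(nat, 'c) pforest" where "iso_map h F G"
proof -
  obtain h :: "'v \<Rightarrow> nat" where h: "inj_on h (verts F)"
    using finite_imp_inj_to_nat_seg[OF partitioned_forestD(1)[OF F]] by auto
  let ?G = "\<lparr>verts = h ` verts F, edges = map_prod h h ` edges F, blocks = (`) h ` blocks F,
     deco = (\<lambda>y. deco F (inv_into (verts F) h y))\<rparr>"
  have "iso_map h F ?G" using h by (simp add: iso_map_def bij_betw_def)
  then show thesis by (rule that)
qed

text \<open>The choice in \<open>rep\<close> is made from a nonempty set, since every finite forest
  has a copy on \<open>nat\<close>. Computations with representatives pass through this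
  isomorphism.\<close>

lemma iso_map_rep:
  assumes F: "partitioned_forest F"
  obtains h where "iso_map h F (rep (iso_class F))"
proof -
  obtain h and G :: "(nat, 'b) pforest" where "iso_map h F G"
    by (rule ex_iso_map_nat[OF F])
  then have "G \<in> iso_class F"
    by (auto simp: iso_class_def pforest_iso_iff)
  then have "rep (iso_class F) \<in> iso_class F" by (auto simp: rep_def intro: someI)
  then show thesis using that by (auto simp: iso_class_def pforest_iso_iff)
qed

lemma iso_class_eqD:
  assumes F: "partitioned_forest F" and G: "partitioned_forest G" and eq: "iso_class F = iso_class G"
  shows "\<exists>h. iso_map h F G"
proof -
  obtain h k where "iso_map h F (rep (iso_class F))" "iso_map k G (rep (iso_class F))"
    using iso_map_rep[OF F] iso_map_rep[OF G] eq by metis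
  then show ?thesis using iso_map_trans[OF _ iso_map_inv[OF G]] by blast
qed

text \<open>Climb from a vertex to its parent as long as there is one; well-foundedness ends the
  climb at a root.\<close>

lemma roots_nonempty:
  assumes F: "partitioned_forest F" and "x \<in> verts F"
  obtains r where "r \<in> roots F" "(r, x) \<in> (edges F)\<^sup>*"
proof -
  have "\<exists>r. r \<in> roots F \<and> (r, x) \<in> (edges F)\<^sup>*" using assms(2)
  proof (induction x rule: wf_induct_rule[OF partitioned_forestD(4)[OF F]])
    case (1 x)
    show ?case
    proof (cases "x \<in> roots F")
      case False
      then obtain u where u: "(u, x) \<in> edges F" using 1 by (auto simp: roots_def)
      then have "u \<in> verts F" using partitioned_forestD(2)[OF F] by auto
      with 1(1)[OF u] u show ?thesis by (meson rtrancl.rtrancl_into_rtrancl)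
    qed auto
  qed
  then show thesis using that by blast
qed

text \<open>The definition only provides a block that contains the roots. A block meeting the roots
  contains no vertex with a parent, so the two sets coincide.\<close>

lemma root_block:
  assumes F: "partitioned_tree F" and "verts F \<noteq> {}"
  shows "roots F \<in> blocks F"
proof -
  have F': "partitioned_forest F" using F by (rule partitioned_treeD)
  obtain B where B: "B \<in> blocks F" "roots F \<subseteq> B"
    using assms by (auto simp: partitioned_tree_def)
  obtain r where r: "r \<in> roots F" using assms(2) roots_nonempty[OF F'] by auto
  have "x \<in> roots F" if "x \<in> B" for x
    using partitioned_forestD(7)[OF F' B(1) that, of r] r B(2) by (auto simp: roots_def)
  with B show ?thesis by (metis subsetI subset_antisym)
qed

text \<open>These are the blocks that \<open>merge\<close> copies unchanged. In the empty forest
  nothing is removed, as there is no block at all.\<close>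

lemma partition_nonroots:
  assumes F: "partitioned_tree F"
  shows "partition_on (verts F - roots F) (blocks F - {roots F})"
proof (cases "verts F = {}")
  case True
  then show ?thesis
    using partitioned_forestD(6)[OF partitioned_treeD[OF F]] by (simp add: partition_on_empty)
next
  case False
  then show ?thesis
    by (intro partition_on_remove root_block F partitioned_forestD(6)[OF partitioned_treeD])
qed

lemma nonroot_block:
  assumes F: "partitioned_tree F" and "B \<in> blocks F" "B \<noteq> roots F" "x \<in> B" "y \<in> B"
  shows "\<exists>u. (u, x) \<in> edges F \<and> (u, y) \<in> edges F"
proof -
  have "x \<in> verts F - roots F" using assms partition_nonroots[OF F] by (auto simp: partition_on_def)
  then show ?thesis using partitioned_forestD(7)[OF partitioned_treeD[OF F], of B x y] assms by auto
qed

section \<open>Merging, grafting and redecorating\<close>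

lemma edges_merge_iff [simp]:
  "(Inl u, Inl x) \<in> edges (merge F G) \<longleftrightarrow> (u, x) \<in> edges F"
  "(Inr v, Inr y) \<in> edges (merge F G) \<longleftrightarrow> (v, y) \<in> edges G"
  "(Inl u, Inr y) \<notin> edges (merge F G)"
  "(Inr v, Inl x) \<notin> edges (merge F G)"
  by (auto simp: merge_def)

lemma edges_graft_iff [simp]:
  "(Inl u, Inl x) \<in> edges (graft F s G) \<longleftrightarrow> (u, x) \<in> edges F"
  "(Inr v, Inr y) \<in> edges (graft F s G) \<longleftrightarrow> (v, y) \<in> edges G"
  "(Inl u, Inr y) \<in> edges (graft F s G) \<longleftrightarrow> u = s \<and> y \<in> roots G"
  "(Inr v, Inl x) \<notin> edges (graft F s G)"
  by (auto simp: graft_def)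

lemma verts_merge_graft [simp]:
  "verts (merge F G) = Inl ` verts F \<union> Inr ` verts G"
  "verts (graft F s G) = Inl ` verts F \<union> Inr ` verts G"
  by (simp_all add: merge_def graft_def)

lemma roots_merge: "roots (merge F G) = Inl ` roots F \<union> Inr ` roots G"
  by (auto simp: roots_def split_sum_all)

lemma roots_graft: "s \<in> verts F \<Longrightarrow> edges G \<subseteq> verts G \<times> verts G \<Longrightarrow> roots (graft F s G) = Inl ` roots F"
  by (auto simp: roots_def split_sum_all)

lemma wf_Inl_image: "wf r \<Longrightarrow> wf (map_prod Inl Inl ` r)"
  by (rule wf_map_prod_image) auto

lemma wf_Inr_image: "wf r \<Longrightarrow> wf (map_prod Inr Inr ` r)"
  by (rule wf_map_prod_image) auto

lemma partitioned_tree_merge: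
  assumes F: "partitioned_tree F" and G: "partitioned_tree G"
  shows "partitioned_tree (merge F G)"
proof -
  note FD = partitioned_forestD[OF partitioned_treeD[OF F]]
  note GD = partitioned_forestD[OF partitioned_treeD[OF G]]
  let ?R = "Inl ` roots F \<union> Inr ` roots G"
  have sub: "roots F \<subseteq> verts F" "roots G \<subseteq> verts G" by (rule roots_subset)+
  \<comment> \<open>If both trees are empty, the merged block is empty and \<open>merge\<close>
    discards it; both the set and its partition are then empty.\<close>
  have pR: "partition_on ?R ({?R} - {{}})"
    by (cases "?R = {}") (simp_all only: Diff_cancel partition_on_empty, simp_all add: partition_on_space)
  have "partition_on (Inl ` (verts F - roots F) \<union> Inr ` (verts G - roots G))
      ((`) Inl ` (blocks F - {roots F}) \<union> (`) Inr ` (blocks G - {roots G}))"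
    by (intro partition_on_Un partition_on_inj_image' partition_nonroots F G) auto
  then have "partition_on ((Inl ` (verts F - roots F) \<union> Inr ` (verts G - roots G)) \<union> ?R)
      ((`) Inl ` (blocks F - {roots F}) \<union> (`) Inr ` (blocks G - {roots G}) \<union> ({?R} - {{}}))"
    by (rule partition_on_Un[OF _ pR]) auto
  also have "(Inl ` (verts F - roots F) \<union> Inr ` (verts G - roots G)) \<union> ?R = verts (merge F G)"
    using sub by (auto simp: merge_def)
  also have "((`) Inl ` (blocks F - {roots F}) \<union> (`) Inr ` (blocks G - {roots G}) \<union> ({?R} - {{}}))
      = blocks (merge F G)" by (simp add: merge_def)
  finally have part: "partition_on (verts (merge F G)) (blocks (merge F G))" .
  have "partitioned_forest (merge F G)"
  proof (rule partitioned_forestI[OF _ _ _ _ part])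
    show "finite (verts (merge F G))" using FD(1) GD(1) by (simp add: merge_def)
    show "edges (merge F G) \<subseteq> verts (merge F G) \<times> verts (merge F G)"
      using FD(2) GD(2) by (auto simp: merge_def)
    have "wf (map_prod Inl Inl ` edges F \<union> map_prod Inr Inr ` edges G)"
      by (intro wf_Un wf_Inl_image wf_Inr_image FD GD) auto
    then show "wf (edges (merge F G))" by (simp add: merge_def)
    show "u = w" if "(u, x) \<in> edges (merge F G)" "(w, x) \<in> edges (merge F G)" for u w x
      using that FD(5) GD(5) by (auto simp: merge_def)
    fix B x y assume B: "B \<in> blocks (merge F G)" "x \<in> B" "y \<in> B"
    from B(1) have "B \<in> (`) Inl ` (blocks F - {roots F}) \<or> B \<in> (`) Inr ` (blocks G - {roots G}) \<or> B = ?R"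
      unfolding merge_def pforest.simps by (elim UnE) simp_all
    then show "x \<in> roots (merge F G) \<and> y \<in> roots (merge F G) \<or>
        (\<exists>u. (u, x) \<in> edges (merge F G) \<and> (u, y) \<in> edges (merge F G))"
    proof (elim disjE)
      assume "B \<in> (`) Inl ` (blocks F - {roots F})"
      then obtain B' where l: "B = Inl ` B'" "B' \<in> blocks F" "B' \<noteq> roots F"
        by (elim imageE DiffE) simp
      with B obtain x' y' where xy: "x = Inl x'" "y = Inl y'" "x' \<in> B'" "y' \<in> B'" by auto
      from nonroot_block[OF F l(2,3) xy(3,4)] obtain u where "(u, x') \<in> edges F" "(u, y') \<in> edges F"
        by blast
      then have "(Inl u, x) \<in> edges (merge F G) \<and> (Inl u, y) \<in> edges (merge F G)"
        by (auto simp: merge_def xy intro: map_prod_imageI)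
      then show ?thesis by blast
    next
      assume "B \<in> (`) Inr ` (blocks G - {roots G})"
      then obtain B' where r: "B = Inr ` B'" "B' \<in> blocks G" "B' \<noteq> roots G"
        by (elim imageE DiffE) simp
      with B obtain x' y' where xy: "x = Inr x'" "y = Inr y'" "x' \<in> B'" "y' \<in> B'" by auto
      from nonroot_block[OF G r(2,3) xy(3,4)] obtain u where "(u, x') \<in> edges G" "(u, y') \<in> edges G"
        by blast
      then have "(Inr u, x) \<in> edges (merge F G) \<and> (Inr u, y) \<in> edges (merge F G)"
        by (auto simp: merge_def xy intro: map_prod_imageI)
      then show ?thesis by blast
    next
      assume "B = ?R"
      with B show ?thesis by (simp add: roots_merge)
    qed
  qed
  moreover have "verts (merge F G) = {} \<or> (\<exists>B\<in>blocks (merge F G). roots (merge F G) \<subseteq> B)"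
  proof (cases "verts (merge F G) = {}")
    case False
    then have "roots F \<noteq> {} \<or> roots G \<noteq> {}"
      using root_block[OF F] root_block[OF G] FD(9)[of "roots F"] GD(9)[of "roots G"]
      by auto
    then have "?R \<in> {?R} - {{}}" by blast
    then have "?R \<in> blocks (merge F G)" unfolding merge_def pforest.simps by (rule UnI2)
    then show ?thesis unfolding roots_merge by blast
  qed simp
  ultimately show ?thesis by (simp add: partitioned_tree_def)
qed

lemma partitioned_tree_graft:
  assumes F: "partitioned_tree F" and G: "partitioned_tree G" and s: "s \<in> verts F"
  shows "partitioned_tree (graft F s G)"
proof -
  note FD = partitioned_forestD[OF partitioned_treeD[OF F]]
  note GD = partitioned_forestD[OF partitioned_treeD[OF G]]
  have roots: "roots (graft F s G) = Inl ` roots F" by (rule roots_graft[OF s GD(2)])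
  have rG: "roots G \<subseteq> verts G" by (rule roots_subset)
  have part: "partition_on (verts (graft F s G)) (blocks (graft F s G))"
    unfolding graft_def pforest.simps
    by (intro partition_on_Un partition_on_inj_image' FD GD) auto
  have "partitioned_forest (graft F s G)"
  proof (rule partitioned_forestI[OF _ _ _ _ part])
    show "finite (verts (graft F s G))" using FD(1) GD(1) by (simp add: graft_def)
    show "edges (graft F s G) \<subseteq> verts (graft F s G) \<times> verts (graft F s G)"
      using FD(2) GD(2) s rG by (auto simp: graft_def)
    \<comment> \<open>Every new edge goes from the left summand to the right one, so
      \<open>isl\<close> maps it to the single pair \<open>(True, False)\<close>.\<close>
    have 1: "wf {(Inl s, Inr r) | r. r \<in> roots G}"
      by (rule wf_subset[of "inv_image {(True, False)} isl"]) (auto intro!: wf_inv_image simp: wf_insert)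
    \<comment> \<open>The grouping matters: the domain of each left-hand part consists of
      \<open>Inl\<close> vertices and misses the range of the rest, as \<open>wf_Un\<close>
      demands.\<close>
    have "wf (map_prod Inl Inl ` edges F \<union> ({(Inl s, Inr r) | r. r \<in> roots G}
              \<union> map_prod Inr Inr ` edges G))"
      by (intro wf_Un 1 wf_Inl_image wf_Inr_image FD GD) auto
    then show "wf (edges (graft F s G))" by (simp add: graft_def Un_ac)
    show "u = w" if "(u, x) \<in> edges (graft F s G)" "(w, x) \<in> edges (graft F s G)" for u w x
      using that FD(5) GD(5) by (auto simp: graft_def roots_def)
    fix B x y assume B: "B \<in> blocks (graft F s G)" "x \<in> B" "y \<in> B"
    then consider (l) B' where "B = Inl ` B'" "B' \<in> blocks F"
      | (r) B' where "B = Inr ` B'" "B' \<in> blocks G"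
      by (auto simp: graft_def)
    then show "x \<in> roots (graft F s G) \<and> y \<in> roots (graft F s G) \<or>
        (\<exists>u. (u, x) \<in> edges (graft F s G) \<and> (u, y) \<in> edges (graft F s G))"
    proof cases
      case l
      with B obtain x' y' where xy: "x = Inl x'" "y = Inl y'" "x' \<in> B'" "y' \<in> B'" by auto
      from FD(7)[OF l(2) xy(3,4)] show ?thesis
        by (auto simp: xy roots) (auto simp: graft_def intro!: map_prod_imageI)
    next
      case r
      with B obtain x' y' where xy: "x = Inr x'" "y = Inr y'" "x' \<in> B'" "y' \<in> B'" by auto
      from GD(7)[OF r(2) xy(3,4)] show ?thesis
      proof
        assume "x' \<in> roots G \<and> y' \<in> roots G"
        then have "(Inl s, x) \<in> edges (graft F s G) \<and> (Inl s, y) \<in> edges (graft F s G)"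
          by (auto simp: graft_def xy)
        then show ?thesis by blast
      next
        assume "\<exists>u. (u, x') \<in> edges G \<and> (u, y') \<in> edges G"
        then obtain u where "(u, x') \<in> edges G" "(u, y') \<in> edges G" by blast
        then have "(Inr u, x) \<in> edges (graft F s G) \<and> (Inr u, y) \<in> edges (graft F s G)"
          by (auto simp: graft_def xy intro: map_prod_imageI)
        then show ?thesis by blast
      qed
    qed
  qed
  moreover have "roots F \<in> blocks F" using F s by (intro root_block) auto
  then have "Inl ` roots F \<in> blocks (graft F s G)" by (simp add: graft_def)
  ultimately show ?thesis by (auto simp: partitioned_tree_def roots)
qed

text \<open>The common form of \<open>raise\<close> and of substituting a decoration, so that the
  products have to be compared with one operation only.\<close>

definition redec :: "('v, 'c) pforest \<Rightarrow> 'v \<Rightarrow> 'c \<Rightarrow> ('v, 'c) pforest" where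
  "redec F s c = F\<lparr>deco := (deco F)(s := c)\<rparr>"

lemma redec_simps [simp]:
  "verts (redec F s c) = verts F" "edges (redec F s c) = edges F" "blocks (redec F s c) = blocks F"
  "deco (redec F s c) = (deco F)(s := c)"
  by (simp_all add: redec_def)

lemma roots_redec [simp]: "roots (redec F s c) = roots F"
  by (simp add: roots_def)

lemma partitioned_forest_redec [simp]: "partitioned_forest (redec F s c) = partitioned_forest F"
  by (simp add: partitioned_forest_def rooted_forest_def)

lemma partitioned_tree_redec [simp]: "partitioned_tree (redec F s c) = partitioned_tree F"
  by (simp add: partitioned_tree_def)

lemma redec_same [simp]: "redec F s (deco F s) = F"
  by (simp add: redec_def)

lemma redec_redec: "redec (redec F s c) s c' = redec F s c'"
  by (simp add: redec_def)

lemma redec_swap: "s \<noteq> t \<Longrightarrow> redec (redec F s c) t c' = redec (redec F t c') s c"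
  by (simp add: redec_def fun_upd_twist)

lemma raise_redec: "raise F s = redec F s (apfst Suc (deco F s))"
  by (simp add: raise_def redec_def)

lemma merge_redec: "merge (redec F s c) G = redec (merge F G) (Inl s) c"
  by (auto simp: merge_def redec_def roots_def fun_eq_iff split: sum.split)

lemma graft_redec1: "graft (redec F s c) t G = redec (graft F t G) (Inl s) c"
  by (auto simp: graft_def redec_def roots_def fun_eq_iff split: sum.split)

lemma graft_redec2: "graft F t (redec G s c) = redec (graft F t G) (Inr s) c"
  by (auto simp: graft_def redec_def roots_def fun_eq_iff split: sum.split)

lemma iso_map_redec:
  assumes "iso_map h F G" "s \<in> verts F"
  shows "iso_map h (redec F s c) (redec G (h s) c)"
  using assms by (auto simp: iso_map_def bij_betw_def dest: inj_onD)

lemma map_sum_bij_betw: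
  assumes "bij_betw h A A'" "bij_betw k B B'"
  shows "bij_betw (map_sum h k) (Inl ` A \<union> Inr ` B) (Inl ` A' \<union> Inr ` B')"
proof (rule bij_betw_imageI)
  have i: "inj_on h A" "inj_on k B" and "h ` A = A'" "k ` B = B'"
    using assms by (simp_all add: bij_betw_def)
  then show "map_sum h k ` (Inl ` A \<union> Inr ` B) = Inl ` A' \<union> Inr ` B'"
    unfolding image_Un image_image by (simp flip: image_image)
  show "inj_on (map_sum h k) (Inl ` A \<union> Inr ` B)"
    by (rule inj_onI) (auto dest: inj_onD[OF i(1)] inj_onD[OF i(2)])
qed

lemma iso_map_merge:
  assumes F: "partitioned_forest F" and G: "partitioned_forest G"
    and h: "iso_map h F F'" and k: "iso_map k G G'"
  shows "iso_map (map_sum h k) (merge F G) (merge F' G')"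
proof -
  \<comment> \<open>The set difference in \<open>merge\<close> survives the image because
    \<open>h\<close> is injective on subsets of the vertex set.\<close>
  have b: "(`) h ` (blocks F - {roots F}) = blocks F' - {roots F'}"
    if F: "partitioned_forest F" and h: "iso_map h F F'" for F :: "('x, 'y) pforest" and F' :: "('z, 'y) pforest" and h
  proof -
    have "inj_on ((`) h) (Pow (verts F))"
      using h by (intro inj_on_image_Pow) (simp add: iso_map_def bij_betw_def)
    then have "(`) h ` (blocks F - {roots F}) = (`) h ` blocks F - (`) h ` {roots F}"
      using partitioned_forestD(8)[OF F] roots_subset[of F] by (intro inj_on_image_set_diff) auto
    then show ?thesis using h iso_map_roots[OF F h] by (simp add: iso_map_def)
  qed
  have v: "bij_betw (map_sum h k) (verts (merge F G)) (verts (merge F' G'))"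
    using h k by (auto simp: iso_map_def merge_def intro: map_sum_bij_betw)
  have e: "edges (merge F' G') = map_prod (map_sum h k) (map_sum h k) ` edges (merge F G)"
    using h k by (simp add: iso_map_def merge_def image_Un image_image prod.map_comp comp_def)
  have "blocks (merge F' G') = (`) (map_sum h k) ` blocks (merge F G)"
    unfolding merge_def pforest.simps b[OF F h, symmetric] b[OF G k, symmetric]
    unfolding iso_map_roots[OF F h] iso_map_roots[OF G k]
    by (auto simp: image_Un image_image)
  moreover have "\<forall>x\<in>verts F. deco F' (h x) = deco F x" "\<forall>x\<in>verts G. deco G' (k x) = deco G x"
    using h k by (simp_all add: iso_map_def)
  then have "\<forall>x\<in>verts (merge F G). deco (merge F' G') (map_sum h k x) = deco (merge F G) x"
    by (auto simp: merge_def)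
  ultimately show ?thesis
    using v e by (simp add: iso_map_def)
qed

lemma iso_map_graft:
  assumes F: "partitioned_forest F" and G: "partitioned_forest G"
    and h: "iso_map h F F'" and k: "iso_map k G G'"
  shows "iso_map (map_sum h k) (graft F s G) (graft F' (h s) G')"
proof -
  have v: "bij_betw (map_sum h k) (verts (graft F s G)) (verts (graft F' (h s) G'))"
    using h k by (auto simp: iso_map_def graft_def intro: map_sum_bij_betw)
  have r: "{(Inl (h s), Inr r) |r. r \<in> roots G'}
      = map_prod (map_sum h k) (map_sum h k) ` {(Inl s, Inr r) |r. r \<in> roots G}"
    unfolding iso_map_roots[OF G k] by force
  have e: "edges (graft F' (h s) G') = map_prod (map_sum h k) (map_sum h k) ` edges (graft F s G)"
    using h k unfolding graft_def pforest.simps r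
    by (simp add: iso_map_def image_Un image_image prod.map_comp comp_def)
  have "blocks (graft F' (h s) G') = (`) (map_sum h k) ` blocks (graft F s G)"
    using h k by (simp add: iso_map_def graft_def image_Un image_image)
  moreover have "\<forall>x\<in>verts F. deco F' (h x) = deco F x" "\<forall>x\<in>verts G. deco G' (k x) = deco G x"
    using h k by (simp_all add: iso_map_def)
  then have "\<forall>x\<in>verts (graft F s G). deco (graft F' (h s) G') (map_sum h k x) = deco (graft F s G) x"
    by (auto simp: graft_def)
  ultimately show ?thesis
    using v e by (simp add: iso_map_def)
qed

section \<open>Decomposition of partitioned trees\<close>

text \<open>Blocks are intersected with \<open>W\<close> instead of being selected, since splitting
  a tree with several roots has to cut its root block in two.\<close>

definition subforest :: "('v, 'c) pforest \<Rightarrow> 'v set \<Rightarrow> ('v, 'c) pforest" where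
  "subforest F W = \<lparr>verts = W, edges = edges F \<inter> W \<times> W, blocks = (\<inter>) W ` blocks F - {{}}, deco = deco F\<rparr>"

lemma subforest_simps [simp]:
  "verts (subforest F W) = W" "edges (subforest F W) = edges F \<inter> W \<times> W" "deco (subforest F W) = deco F"
  by (simp_all add: subforest_def)

lemma partitioned_forest_subforest:
  assumes F: "partitioned_forest F" and W: "W \<subseteq> verts F"
  shows "partitioned_forest (subforest F W)"
proof (rule partitioned_forestI)
  note FD = partitioned_forestD[OF F]
  show "finite (verts (subforest F W))" using FD(1) W by (simp add: finite_subset)
  show "edges (subforest F W) \<subseteq> verts (subforest F W) \<times> verts (subforest F W)" by auto
  show "wf (edges (subforest F W))" using FD(4) by (auto intro: wf_subset)
  show "u = w" if "(u, x) \<in> edges (subforest F W)" "(w, x) \<in> edges (subforest F W)" for u w x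
    using that FD(5) by auto
  show "partition_on (verts (subforest F W)) (blocks (subforest F W))"
    using partition_on_restrict[OF FD(6), of W] W by (simp add: subforest_def Int_absorb2)
  fix B x y assume "B \<in> blocks (subforest F W)" "x \<in> B" "y \<in> B"
  then obtain B' where *: "B' \<in> blocks F" "x \<in> B'" "y \<in> B'" "x \<in> W" "y \<in> W"
    by (auto simp: subforest_def)
  from FD(7)[OF *(1-3)]
  show "x \<in> roots (subforest F W) \<and> y \<in> roots (subforest F W) \<or> (\<exists>u. (u, x) \<in> edges (subforest F W) \<and> (u, y) \<in> edges (subforest F W))"
  proof
    assume "x \<in> roots F \<and> y \<in> roots F"
    with * show ?thesis by (auto simp: roots_def)
  next
    assume "\<exists>u. (u, x) \<in> edges F \<and> (u, y) \<in> edges F"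
    then obtain u where u: "(u, x) \<in> edges F" "(u, y) \<in> edges F" by blast
    show ?thesis
    proof (cases "u \<in> W")
      case True
      with u * show ?thesis by auto
    next
      \<comment> \<open>Both vertices lose their common parent, so both become roots of the
        subforest.\<close>
      case False
      then have "(v, x) \<notin> edges (subforest F W)" "(v, y) \<notin> edges (subforest F W)" for v
        using FD(5)[OF u(1)] FD(5)[OF u(2)] by auto
      with * show ?thesis by (auto simp: roots_def)
    qed
  qed
qed

lemma nonroot_block_disjoint:
  assumes "partitioned_tree F" "B \<in> blocks F" "B \<noteq> roots F"
  shows "B \<inter> roots F = {}" "B \<noteq> {}" "B \<subseteq> verts F"
  using partition_nonroots[OF assms(1)] assms(2,3) by (auto simp: partition_on_def)

text \<open>No edge crosses the boundary of \<open>W\<close>, so climbing from a vertex of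
  \<open>W\<close> to its root stays in \<open>W\<close>. A nonempty \<open>W\<close> thus meets the
  root block, and what remains of that block is the root block of the subforest.\<close>

lemma union_of_components:
  assumes F: "partitioned_tree F" and W: "W \<subseteq> verts F"
    and closed: "\<And>u x. (u, x) \<in> edges F \<Longrightarrow> u \<in> W \<longleftrightarrow> x \<in> W"
  shows "roots (subforest F W) = roots F \<inter> W" "partitioned_tree (subforest F W)"
proof -
  note F' = partitioned_treeD[OF F]
  show r: "roots (subforest F W) = roots F \<inter> W"
    using closed W by (auto simp: roots_def)
  show "partitioned_tree (subforest F W)"
  proof (cases "W = {}")
    case True
    then show ?thesis by (simp add: partitioned_tree_def partitioned_forest_subforest[OF F'])
  next
    case False
    then obtain x where x: "x \<in> W" by auto
    then obtain r where r': "r \<in> roots F" "(r, x) \<in> (edges F)\<^sup>*"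
      using roots_nonempty[OF F'] W by blast
    from r'(2) x have "r \<in> W"
      by (induction rule: converse_rtrancl_induct) (auto simp: closed)
    moreover have "roots F \<in> blocks F" using W x by (intro root_block F) auto
    ultimately have "roots (subforest F W) \<in> blocks (subforest F W)"
      using r r'(1) by (auto simp: subforest_def)
    then show ?thesis
      using partitioned_forest_subforest[OF F' W] by (auto simp: partitioned_tree_def)
  qed
qed

text \<open>A block other than the root block has a common parent and therefore lies on one side;
  the root block is cut in two and glued together again by \<open>merge\<close>.\<close>

lemma iso_map_merge_subforest:
  assumes F: "partitioned_tree F" and W: "W \<subseteq> verts F"
    and closed: "\<And>u x. (u, x) \<in> edges F \<Longrightarrow> u \<in> W \<longleftrightarrow> x \<in> W"
  shows "iso_map (case_sum id id) (merge (subforest F W) (subforest F (verts F - W))) F"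
proof -
  let ?W = "verts F - W" and ?k = "case_sum id id :: 'a + 'a \<Rightarrow> 'a"
  note FD = partitioned_forestD[OF partitioned_treeD[OF F]]
  have closed': "u \<in> ?W \<longleftrightarrow> x \<in> ?W" if "(u, x) \<in> edges F" for u x
    using that FD(2) closed by blast
  have r: "roots (subforest F W) = W \<inter> roots F" "roots (subforest F ?W) = ?W \<inter> roots F"
    using union_of_components(1)[OF F W closed] union_of_components(1)[OF F _ closed'] by auto
  have 1: "bij_betw ?k (verts (merge (subforest F W) (subforest F ?W))) (verts F)"
    using W by (auto simp: bij_betw_def inj_on_def image_Un image_image)
  have "edges F = edges F \<inter> W \<times> W \<union> edges F \<inter> ?W \<times> ?W"
    using FD(2) closed by blast
  then have 2: "edges F = map_prod ?k ?k ` edges (merge (subforest F W) (subforest F ?W))"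
    by (simp add: merge_def image_Un image_image prod.map_comp comp_def map_prod_def split_beta)
  have inside: "B \<subseteq> W \<or> B \<subseteq> ?W" if "B \<in> blocks F" "B \<noteq> roots F" for B
    using nonroot_block[OF F that] closed FD(8)[OF that(1)] by blast
  \<comment> \<open>Here \<open>X\<close> stands for \<open>W\<close> or its complement: cutting a
    non-root block by \<open>X\<close> returns the block or leaves nothing.\<close>
  have split: "(\<inter>) X ` blocks F - {{}} - {X \<inter> roots F} = {B \<in> blocks F. B \<noteq> roots F \<and> B \<subseteq> X}"
    if X: "\<And>B. B \<in> blocks F \<Longrightarrow> B \<noteq> roots F \<Longrightarrow> B \<subseteq> X \<or> X \<inter> B = {}" for X
  proof (intro equalityI subsetI)
    fix C assume C: "C \<in> (\<inter>) X ` blocks F - {{}} - {X \<inter> roots F}"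
    then obtain B where B: "C = X \<inter> B" "B \<in> blocks F" "B \<noteq> roots F" by blast
    then have "C = B" using X[OF B(2,3)] C by blast
    with B show "C \<in> {B \<in> blocks F. B \<noteq> roots F \<and> B \<subseteq> X}" by auto
  next
    fix B assume B: "B \<in> {B \<in> blocks F. B \<noteq> roots F \<and> B \<subseteq> X}"
    then have "B = X \<inter> B" "B \<inter> roots F = {}" "B \<noteq> {}"
      using nonroot_block_disjoint[OF F, of B] by auto
    with B show "B \<in> (\<inter>) X ` blocks F - {{}} - {X \<inter> roots F}" by blast
  qed
  have m: "(`) ?k ` ({Inl ` X \<union> Inr ` Y} - {{}}) = {X \<union> Y} - {{}}" for X Y
    by (cases "X = {} \<and> Y = {}") (auto simp: image_Un image_image)
  have "(`) ?k ` blocks (merge (subforest F W) (subforest F ?W)) =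
      ((\<inter>) W ` blocks F - {{}} - {W \<inter> roots F}) \<union> ((\<inter>) ?W ` blocks F - {{}} - {?W \<inter> roots F})
      \<union> ({(W \<inter> roots F) \<union> (?W \<inter> roots F)} - {{}})"
    unfolding merge_def pforest.simps r image_Un[where f = "(`) ?k"] m
    by (simp add: subforest_def image_image)
  also have "(W \<inter> roots F) \<union> (?W \<inter> roots F) = roots F"
    using roots_subset[of F] by blast
  also have "((\<inter>) W ` blocks F - {{}} - {W \<inter> roots F}) = {B \<in> blocks F. B \<noteq> roots F \<and> B \<subseteq> W}"
    using inside by (intro split) blast
  also have "((\<inter>) ?W ` blocks F - {{}} - {?W \<inter> roots F}) = {B \<in> blocks F. B \<noteq> roots F \<and> B \<subseteq> ?W}"
    using inside by (intro split) blast
  also have "{B \<in> blocks F. B \<noteq> roots F \<and> B \<subseteq> W} \<union> {B \<in> blocks F. B \<noteq> roots F \<and> B \<subseteq> ?W} \<union> ({roots F} - {{}})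
      = blocks F"
  proof -
    have "roots F \<in> blocks F \<or> roots F = {}"
      using root_block[OF F] by (auto simp: roots_def)
    moreover have "roots F \<noteq> {}" if "roots F \<in> blocks F" using FD(9)[OF that] .
    ultimately show ?thesis using inside by blast
  qed
  finally have 3: "blocks F = (`) ?k ` blocks (merge (subforest F W) (subforest F ?W))" by (rule sym)
  have "\<forall>x\<in>verts (merge (subforest F W) (subforest F ?W)). deco F (?k x) = deco (merge (subforest F W) (subforest F ?W)) x"
    by (simp add: merge_def ball_Un)
  with 1 2 3 show ?thesis unfolding iso_map_def by blast
qed

text \<open>\<open>W\<close> consists of a block of siblings and all their descendants. The only
  edges between \<open>W\<close> and its complement lead from \<open>r\<close> to \<open>B\<close>,
  and these are the edges that grafting restores.\<close>

lemma descendants_of_block: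
  assumes F: "partitioned_tree F" and B: "B \<in> blocks F" and r: "\<And>x. x \<in> B \<Longrightarrow> (r, x) \<in> edges F"
    and W: "W = (edges F)\<^sup>* `` B"
  shows "W \<subseteq> verts F" "r \<in> verts F - W" "roots (subforest F W) = B" "roots (subforest F (verts F - W)) = roots F"
    "partitioned_tree (subforest F W)" "partitioned_tree (subforest F (verts F - W))"
    "iso_map (case_sum id id) (graft (subforest F (verts F - W)) r (subforest F W)) F"
proof -
  let ?W = "verts F - W" and ?k = "case_sum id id :: 'a + 'a \<Rightarrow> 'a"
  note F' = partitioned_treeD[OF F]
  note FD = partitioned_forestD[OF F']
  have up: "x \<in> W" if "(u, x) \<in> edges F" "u \<in> W" for u x
    using that unfolding W by (meson Image_iff rtrancl.rtrancl_into_rtrancl)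
  have BW: "B \<subseteq> W" by (auto simp: W)
  have down: "x \<in> B \<or> (\<exists>u\<in>W. (u, x) \<in> edges F)" if x: "x \<in> W" for x
  proof -
    obtain b where "b \<in> B" "(b, x) \<in> (edges F)\<^sup>*" using x by (auto simp: W)
    from this(2,1) show ?thesis by (cases rule: rtranclE) (auto simp: W)
  qed
  have down': "u \<in> W \<or> x \<in> B" if "x \<in> W" "(u, x) \<in> edges F" for u x
    using down[OF that(1)] FD(5)[OF that(2)] by blast
  obtain b where b: "b \<in> B" using FD(9)[OF B] by blast
  show sub: "W \<subseteq> verts F" using down FD(2) FD(8)[OF B] by blast
  \<comment> \<open>A path from \<open>B\<close> to \<open>r\<close> would close a cycle with the
    edge from \<open>r\<close> to its starting point.\<close>
  have "r \<notin> W"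
  proof
    assume "r \<in> W"
    then obtain c where c: "c \<in> B" "(c, r) \<in> (edges F)\<^sup>*" by (auto simp: W)
    with r[OF c(1)] have "(c, c) \<in> (edges F)\<^sup>+" by (meson rtrancl_into_trancl1)
    with FD(3) show False by (auto simp: acyclic_def)
  qed
  with r[OF b] FD(2) show rW: "r \<in> verts F - W" by auto
  \<comment> \<open>A block straddling the boundary would contain a vertex of \<open>W\<close>
    outside \<open>B\<close>. The parent of this vertex is in \<open>W\<close>; the whole block
    shares this parent and so lies in \<open>W\<close>.\<close>
  have inside: "B' \<subseteq> W \<or> B' \<inter> W = {}" if B': "B' \<in> blocks F" for B'
  proof (cases "B' = B")
    case False
    then have disj: "B' \<inter> B = {}"
      using FD(6) B B' by (auto simp: partition_on_def disjoint_def)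
    show ?thesis
    proof (rule ccontr)
      assume "\<not> ?thesis"
      then obtain x y where xy: "x \<in> B'" "x \<in> W" "y \<in> B'" "y \<notin> W" by blast
      with disj obtain u where u: "u \<in> W" "(u, x) \<in> edges F" using down[of x] by blast
      then have "x \<notin> roots F" by (auto simp: roots_def)
      with FD(7)[OF B' xy(1,3)] obtain v where v: "(v, x) \<in> edges F" "(v, y) \<in> edges F" by blast
      with FD(5)[OF u(2)] u(1) up xy(4) show False by blast
    qed
  qed (use BW in blast)
  show rH: "roots (subforest F W) = B"
  proof (intro equalityI subsetI)
    fix x assume "x \<in> roots (subforest F W)"
    then show "x \<in> B" using down by (auto simp: roots_def)
  next
    fix x assume x: "x \<in> B"
    then have "u \<notin> W" if "(u, x) \<in> edges F" for u
      using FD(5)[OF that r[OF x]] rW by blast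
    with x BW show "x \<in> roots (subforest F W)" by (auto simp: roots_def)
  qed
  have nr: "roots F \<inter> W = {}"
    using down r by (auto simp: roots_def)
  show rG: "roots (subforest F ?W) = roots F"
  proof (intro equalityI subsetI)
    fix x assume "x \<in> roots (subforest F ?W)"
    then show "x \<in> roots F" using up FD(2) by (auto simp: roots_def) 
  next
    fix x assume "x \<in> roots F"
    then show "x \<in> roots (subforest F ?W)" using nr by (auto simp: roots_def)
  qed
  have "B \<in> blocks (subforest F W)" using B BW b by (auto simp: subforest_def)
  then show "partitioned_tree (subforest F W)"
    using partitioned_forest_subforest[OF F' sub] rH by (auto simp: partitioned_tree_def)
  have "roots F \<in> blocks F" using rW by (intro root_block F) auto
  moreover have "roots F = ?W \<inter> roots F" using nr roots_subset[of F] by blast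
  ultimately have "roots F \<in> blocks (subforest F ?W)"
    using FD(9) by (auto simp: subforest_def)
  then show "partitioned_tree (subforest F ?W)"
    using partitioned_forest_subforest[OF F', of ?W] rG by (auto simp: partitioned_tree_def)
  have 1: "bij_betw ?k (verts (graft (subforest F ?W) r (subforest F W))) (verts F)"
    using sub by (auto simp: bij_betw_def inj_on_def image_Un image_image)
  have rp: "map_prod ?k ?k ` {(Inl r, Inr x) | x. x \<in> B} = {r} \<times> B"
    by force
  have "edges F = edges F \<inter> ?W \<times> ?W \<union> edges F \<inter> W \<times> W \<union> {r} \<times> B"
  proof (intro equalityI subrelI)
    fix u x assume e: "(u, x) \<in> edges F"
    have "u = r" if "x \<in> B" using FD(5)[OF e r[OF that]] .
    with e down'[OF _ e] up[OF e] FD(2)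
    show "(u, x) \<in> edges F \<inter> ?W \<times> ?W \<union> edges F \<inter> W \<times> W \<union> {r} \<times> B" by blast
  qed (use r in blast)
  then have 2: "edges F = map_prod ?k ?k ` edges (graft (subforest F ?W) r (subforest F W))"
    unfolding graft_def pforest.simps rH image_Un rp
    by (simp add: image_image prod.map_comp comp_def map_prod_def split_beta)
  have "(`) ?k ` blocks (graft (subforest F ?W) r (subforest F W)) =
      ((\<inter>) ?W ` blocks F - {{}}) \<union> ((\<inter>) W ` blocks F - {{}})"
    by (simp add: graft_def subforest_def image_Un image_image)
  also have "\<dots> = blocks F"
  proof (intro equalityI subsetI)
    fix C assume C: "C \<in> ((\<inter>) ?W ` blocks F - {{}}) \<union> ((\<inter>) W ` blocks F - {{}})"
    then obtain B' where B': "B' \<in> blocks F" "C = ?W \<inter> B' \<or> C = W \<inter> B'" "C \<noteq> {}" by blast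
    then have "C = B'" using inside[OF B'(1)] FD(8)[OF B'(1)] by blast
    with B' show "C \<in> blocks F" by simp
  next
    fix B' assume B': "B' \<in> blocks F"
    then have "B' \<noteq> {}" "B' = ?W \<inter> B' \<or> B' = W \<inter> B'"
      using inside[OF B'] FD(8,9)[OF B'] by blast+
    with B' show "B' \<in> ((\<inter>) ?W ` blocks F - {{}}) \<union> ((\<inter>) W ` blocks F - {{}})" by blast
  qed
  finally have 3: "blocks F = (`) ?k ` blocks (graft (subforest F ?W) r (subforest F W))" by (rule sym)
  have "\<forall>x\<in>verts (graft (subforest F ?W) r (subforest F W)). deco F (?k x) = deco (graft (subforest F ?W) r (subforest F W)) x"
    by (simp add: graft_def ball_Un)
  with 1 2 3 show "iso_map ?k (graft (subforest F ?W) r (subforest F W)) F" unfolding iso_map_def by blast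
qed

text \<open>The marked vertex \<open>s\<close> is followed through the decomposition, since a
  relation singles out one vertex. In the merge case it can be placed in the left factor; in the
  graft case it may lie in either part.\<close>

lemma partitioned_tree_decompose [consumes 2, case_names single merge graft]:
  fixes F :: "('v, 'c) pforest"
  assumes F: "partitioned_tree F" and s: "s \<in> verts F"
  obtains "verts F = {s}"
  | G H :: "('v, 'c) pforest" and h s' where "partitioned_tree G" "partitioned_tree H"
      "verts H \<noteq> {}" "s' \<in> verts G" "iso_map h (merge G H) F" "h (Inl s') = s"
  | G H :: "('v, 'c) pforest" and h r s' where "partitioned_tree G" "partitioned_tree H"
      "verts H \<noteq> {}" "roots G = {r}" "s' \<in> verts (graft G r H)" "iso_map h (graft G r H) F" "h s' = s"
proof -
  note F' = partitioned_treeD[OF F]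
  note FD = partitioned_forestD[OF F']
  obtain r where r: "r \<in> roots F" "(r, s) \<in> (edges F)\<^sup>*" using roots_nonempty[OF F' s] .
  \<comment> \<open>The component of the root above \<open>s\<close>, hence a union of components
    containing \<open>s\<close>.\<close>
  let ?W = "(edges F)\<^sup>* `` {r}"
  show thesis
  proof (cases "roots F = {r}")
    case False
    then obtain r' where r': "r' \<in> roots F" "r' \<noteq> r" using r by blast
    have closed: "u \<in> ?W \<longleftrightarrow> x \<in> ?W" if e: "(u, x) \<in> edges F" for u x
    proof
      assume "u \<in> ?W" with e show "x \<in> ?W" by (auto intro: rtrancl.rtrancl_into_rtrancl)
    next
      assume "x \<in> ?W"
      then have "(r, x) \<in> (edges F)\<^sup>*" by auto
      then show "u \<in> ?W"
      proof (cases rule: rtranclE)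
        case base
        with e r show ?thesis by (auto simp: roots_def)
      next
        case (step y)
        with FD(5)[OF e step(2)] show ?thesis by auto
      qed
    qed
    have W: "?W \<subseteq> verts F"
    proof
      fix x assume "x \<in> ?W"
      then have "(r, x) \<in> (edges F)\<^sup>*" by auto
      then show "x \<in> verts F"
        using r(1) FD(2) by (cases rule: rtranclE) (auto simp: roots_def)
    qed
    have closed': "u \<in> verts F - ?W \<longleftrightarrow> x \<in> verts F - ?W" if "(u, x) \<in> edges F" for u x
      using that FD(2) closed[OF that] by blast
    have "r' \<notin> ?W"
    proof
      assume "r' \<in> ?W"
      then have "(r, r') \<in> (edges F)\<^sup>*" by auto
      then show False using r' by (cases rule: rtranclE) (auto simp: roots_def)
    qed
    moreover have "r' \<in> verts F" using r'(1) roots_subset[of F] by blast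
    ultimately have "verts F - ?W \<noteq> {}" by blast
    then show thesis
      using that(2)[of "subforest F ?W" "subforest F (verts F - ?W)" s "case_sum id id"]
        union_of_components(2)[OF F W closed] union_of_components(2)[OF F _ closed']
        iso_map_merge_subforest[OF F W closed] r(2) by auto
  next
    case True
    show thesis
    proof (cases "verts F = {s}")
      case False
      have "\<exists>x\<in>verts F. x \<notin> roots F"
        using False s r True by auto
      then obtain x where x: "x \<in> verts F" "x \<notin> roots F" by blast
      obtain r'' where "r'' \<in> roots F" "(r'', x) \<in> (edges F)\<^sup>*" using roots_nonempty[OF F' x(1)] .
      then have "(r, x) \<in> (edges F)\<^sup>*" "r \<noteq> x" using True x by auto
      then obtain y where y: "(r, y) \<in> edges F" by (meson converse_rtranclE)
      then have "y \<in> \<Union> (blocks F)" using FD(2,6) by (auto simp: partition_on_def)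
      \<comment> \<open>The block of a child \<open>y\<close> of the root becomes the root block of
        the part that is cut off.\<close>
      then obtain B where B: "B \<in> blocks F" "y \<in> B" by blast
      have "B \<noteq> roots F" using B(2) y by (auto simp: roots_def)
      then have rB: "(r, x) \<in> edges F" if "x \<in> B" for x
        using nonroot_block[OF F B(1) _ B(2) that] FD(5)[OF y] by blast
      define W where "W = (edges F)\<^sup>* `` B"
      note D = descendants_of_block[OF F B(1) rB W_def]
      have bij: "bij_betw (case_sum id id) (verts (graft (subforest F (verts F - W)) r (subforest F W))) (verts F)"
        using D(7) by (simp add: iso_map_def)
      then have "s \<in> case_sum id id ` verts (graft (subforest F (verts F - W)) r (subforest F W))"
        using s by (metis bij_betw_imp_surj_on)
      then obtain s' where "s' \<in> verts (graft (subforest F (verts F - W)) r (subforest F W))" "case_sum id id s' = s"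
        by (elim imageE) metis
      moreover have "W \<noteq> {}" using B(2) by (auto simp: W_def)
      ultimately show thesis
        using that(3)[OF D(6,5) _ _ _ D(7)] D(4) True by simp
    qed (rule that)
  qed
qed

text \<open>Its cardinality is the second measure in the induction of
  \<open>shift_relation_in_ideal\<close>.\<close>

definition rootkids :: "('v, 'c) pforest \<Rightarrow> 'v set" where
  "rootkids F = edges F `` roots F"

lemma iso_map_rootkids:
  assumes F: "partitioned_forest F" and h: "iso_map h F G"
  shows "card (rootkids G) = card (rootkids F)"
proof -
  note FD = partitioned_forestD[OF F]
  have h': "inj_on h (verts F)" "edges G = map_prod h h ` edges F"
    using h by (auto simp: iso_map_def bij_betw_def)
  have "rootkids G = h ` rootkids F"
  proof (intro equalityI subsetI)
    fix y assume "y \<in> rootkids G"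
    then obtain a b c where *: "(a, b) \<in> edges F" "y = h b" "c \<in> roots F" "h c = h a"
      by (auto simp: rootkids_def iso_map_roots[OF F h] h'(2))
    then have "c = a" using h'(1) FD(2) roots_subset[of F] by (auto dest!: inj_onD)
    with * show "y \<in> h ` rootkids F" by (auto simp: rootkids_def)
  next
    fix y assume "y \<in> h ` rootkids F"
    then show "y \<in> rootkids G"
      by (auto simp: rootkids_def iso_map_roots[OF F h] h'(2) Image_iff intro!: map_prod_imageI)
  qed
  moreover have "inj_on h (rootkids F)"
    using h'(1) FD(2) by (auto simp: rootkids_def intro: inj_on_subset)
  ultimately show ?thesis by (simp add: card_image)
qed

lemma iso_map_card: "iso_map h F G \<Longrightarrow> card (verts G) = card (verts F)"
  by (auto simp: iso_map_def dest: bij_betw_same_card)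

text \<open>Grafting at \<open>r\<close> gives the root the roots of \<open>H\<close> as additional
  children, at least one of them; grafting elsewhere gives it none.\<close>

lemma rootkids_graft_less:
  assumes G: "partitioned_tree G" and H: "partitioned_tree H" "verts H \<noteq> {}" and r: "roots G = {r}"
    and v: "v \<in> verts G" "v \<noteq> r"
  shows "card (rootkids (graft G v H)) < card (rootkids (graft G r H))"
proof -
  note GD = partitioned_forestD[OF partitioned_treeD[OF G]]
  note HD = partitioned_forestD[OF partitioned_treeD[OF H(1)]]
  have rG: "r \<in> verts G" using r roots_subset[of G] by auto
  have "rootkids (graft G v H) = Inl ` rootkids G"
    using v by (auto simp: rootkids_def roots_graft[OF v(1) HD(2)] r Image_iff split_sum_all set_eq_iff)
  moreover have "rootkids (graft G r H) = Inl ` rootkids G \<union> Inr ` roots H"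
    by (auto simp: rootkids_def roots_graft[OF rG HD(2)] r Image_iff split_sum_all set_eq_iff)
  moreover have fin: "finite (rootkids G)"
    using GD(1,2) by (auto simp: rootkids_def intro: finite_subset)
  moreover have "finite (roots H)" using HD(1) roots_subset by (rule finite_subset[rotated])
  moreover have "roots H \<noteq> {}" using roots_nonempty[OF partitioned_treeD[OF H(1)]] H(2) by blast
  moreover have "card (Inl ` rootkids G :: ('a + 'c) set) < card (Inl ` rootkids G \<union> Inr ` roots H)"
    using calculation(3-) by (intro psubset_card_mono) auto
  ultimately show ?thesis by simp
qed

section \<open>The ideal generated by the relations\<close>

lemma partitioned_tree_empty_forest: "partitioned_tree empty_forest"
  by (simp add: partitioned_tree_def partitioned_forest_def rooted_forest_def empty_forest_def
      partition_on_def acyclic_def)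

lemma partitioned_tree_one_vertex: "partitioned_tree (one_vertex c)"
  by (simp add: partitioned_tree_def partitioned_forest_def rooted_forest_def one_vertex_def
      partition_on_space acyclic_def roots_def UNIV_unit)

lemma redec_one_vertex: "redec (one_vertex c) s c' = one_vertex c'"
  by (simp add: redec_def one_vertex_def fun_eq_iff)

text \<open>Removes the choice made by \<open>rep\<close> and allows arbitrary vertex types, in
  particular the sum types produced by \<open>merge\<close> and \<open>graft\<close>.\<close>

lemma basis_mult_iso_class:
  assumes F: "partitioned_tree F" and G: "partitioned_tree G"
  shows "basis_mult (iso_class F) (iso_class G) = bas (iso_class (merge F G))"
proof -
  note F' = partitioned_treeD[OF F] and G' = partitioned_treeD[OF G]
  obtain h k where "iso_map h F (rep (iso_class F))" "iso_map k G (rep (iso_class G))"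
    using iso_map_rep[OF F'] iso_map_rep[OF G'] by metis
  from iso_class_eqI[OF partitioned_treeD[OF partitioned_tree_merge[OF F G]] iso_map_merge[OF F' G' this]]
  show ?thesis by (simp add: basis_mult_def)
qed

lemma iso_class_empty_iff:
  assumes F: "partitioned_forest F"
  shows "iso_class F = iso_class empty_forest \<longleftrightarrow> verts F = {}"
proof
  assume "iso_class F = iso_class empty_forest"
  with iso_class_eqD[OF F partitioned_treeD[OF partitioned_tree_empty_forest]]
  obtain h where "iso_map h F empty_forest" by blast
  then show "verts F = {}" by (simp add: iso_map_def bij_betw_def empty_forest_def)
next
  assume v: "verts F = {}"
  then have "edges F = {}" "blocks F = {}"
    using partitioned_forestD(2,6)[OF F] by (auto simp: partition_on_empty)
  \<comment> \<open>Between empty vertex sets any function is an isomorphism.\<close>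
  with v have "iso_map undefined F empty_forest"
    by (simp add: iso_map_def bij_betw_def empty_forest_def)
  then show "iso_class F = iso_class empty_forest" by (rule iso_class_eqI[OF F])
qed

lemma basis_bullet_iso_class:
  assumes F: "partitioned_tree F" and G: "partitioned_tree G" "verts G \<noteq> {}"
  shows "basis_bullet (iso_class F) (iso_class G) = (\<Sum>s\<in>verts F. bas (iso_class (graft F s G)))"
proof -
  note F' = partitioned_treeD[OF F] and G' = partitioned_treeD[OF G(1)]
  obtain h k where hk: "iso_map h F (rep (iso_class F))" "iso_map k G (rep (iso_class G))"
    using iso_map_rep[OF F'] iso_map_rep[OF G'] by metis
  have "basis_bullet (iso_class F) (iso_class G)
      = (\<Sum>s\<in>verts (rep (iso_class F)). bas (iso_class (graft (rep (iso_class F)) s (rep (iso_class G)))))"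
    using iso_class_empty_iff[OF G'] G(2) by (simp add: basis_bullet_def)
  also have "\<dots> = (\<Sum>s\<in>verts F. bas (iso_class (graft (rep (iso_class F)) (h s) (rep (iso_class G)))))"
    using hk(1) by (intro sum.reindex_bij_betw[symmetric]) (simp add: iso_map_def)
  also have "\<dots> = (\<Sum>s\<in>verts F. bas (iso_class (graft F s G)))"
  proof (rule sum.cong)
    fix s assume "s \<in> verts F"
    from iso_class_eqI[OF partitioned_treeD[OF partitioned_tree_graft[OF F G(1) this]] iso_map_graft[OF F' G' hk]]
    show "bas (iso_class (graft (rep (iso_class F)) (h s) (rep (iso_class G)))) = bas (iso_class (graft F s G))"
      by simp
  qed simp
  finally show ?thesis .
qed

lemma partitioned_tree_raise [simp]: "partitioned_tree (raise F s) = partitioned_tree F"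
  by (simp add: raise_redec)

lemma iso_map_raise:
  assumes h: "iso_map h F G" and s: "s \<in> verts F"
  shows "iso_map h (raise F s) (raise G (h s))"
  using iso_map_redec[OF h s, of "apfst Suc (deco F s)"] h s
  by (simp add: raise_redec iso_map_def)

lemma basis_bullet_empty:
  assumes F: "partitioned_tree F"
  shows "basis_bullet (iso_class F) (iso_class empty_forest) = (\<Sum>s\<in>verts F. bas (iso_class (raise F s)))"
proof -
  note F' = partitioned_treeD[OF F]
  obtain h where h: "iso_map h F (rep (iso_class F))"
    using iso_map_rep[OF F'] by metis
  have "basis_bullet (iso_class F) (iso_class empty_forest)
      = (\<Sum>s\<in>verts (rep (iso_class F)). bas (iso_class (raise (rep (iso_class F)) s)))"
    by (simp add: basis_bullet_def)
  also have "\<dots> = (\<Sum>s\<in>verts F. bas (iso_class (raise (rep (iso_class F)) (h s))))"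
    using h by (intro sum.reindex_bij_betw[symmetric]) (simp add: iso_map_def)
  also have "\<dots> = (\<Sum>s\<in>verts F. bas (iso_class (raise F s)))"
  proof (rule sum.cong)
    fix s assume "s \<in> verts F"
    from iso_class_eqI[OF _ iso_map_raise[OF h this]] F
    show "bas (iso_class (raise (rep (iso_class F)) (h s))) = bas (iso_class (raise F s))"
      by (simp add: partitioned_treeD)
  qed simp
  finally show ?thesis .
qed

text \<open>The membership condition of \<open>UPT\<close> for an arbitrary vertex type, as products
  leave the type \<open>nat\<close>.\<close>

definition dtree :: "'d set \<Rightarrow> ('v, nat \<times> 'd) pforest \<Rightarrow> bool" where
  "dtree D F \<longleftrightarrow> partitioned_tree F \<and> (\<forall>s\<in>verts F. snd (deco F s) \<in> D)"

lemma dtreeD: "dtree D F \<Longrightarrow> partitioned_tree F" "dtree D F \<Longrightarrow> partitioned_forest F"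
  by (auto simp: dtree_def partitioned_treeD)

lemma iso_map_dtree:
  assumes "dtree D F" "iso_map h F G"
  shows "dtree D G"
proof -
  have "snd (deco G y) \<in> D" if y: "y \<in> verts G" for y
  proof -
    have "y \<in> h ` verts F" using assms(2) y by (simp add: iso_map_def bij_betw_def)
    then obtain x where "x \<in> verts F" "y = h x" by blast
    with assms show ?thesis by (simp add: iso_map_def dtree_def)
  qed
  with assms iso_map_partitioned_tree show ?thesis by (auto simp: dtree_def)
qed

lemma UPT_iff: "T \<in> UPT D \<longleftrightarrow> (\<exists>F :: (nat, nat \<times> 'd) pforest. T = iso_class F \<and> dtree D F)"
  by (auto simp: UPT_def dtree_def mem_Times_iff)

lemma iso_class_UPT:
  assumes "dtree D F"
  shows "iso_class F \<in> UPT D"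
proof -
  obtain h and G :: "(nat, nat \<times> 'a) pforest" where h: "iso_map h F G"
    using ex_iso_map_nat[OF dtreeD(2)[OF assms]] .
  then show ?thesis
    using iso_class_eqI[OF dtreeD(2)[OF assms] h] iso_map_dtree[OF assms h] UPT_iff by blast
qed

lemma dtree_redec: "dtree D F \<Longrightarrow> snd c \<in> D \<Longrightarrow> dtree D (redec F s c)"
  by (simp add: dtree_def)

lemma dtree_raise: "dtree D F \<Longrightarrow> s \<in> verts F \<Longrightarrow> dtree D (raise F s)"
  by (simp add: dtree_def raise_redec)

lemma dtree_merge: "dtree D F \<Longrightarrow> dtree D G \<Longrightarrow> dtree D (merge F G)"
  by (auto simp: dtree_def partitioned_tree_merge) (auto simp: merge_def)

lemma dtree_graft: "dtree D F \<Longrightarrow> dtree D G \<Longrightarrow> s \<in> verts F \<Longrightarrow> dtree D (graft F s G)"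
  by (auto simp: dtree_def partitioned_tree_graft) (auto simp: graft_def)

lemma dtree_one_vertex: "snd c \<in> D \<Longrightarrow> dtree D (one_vertex c)"
  by (simp add: dtree_def partitioned_tree_one_vertex) (simp add: one_vertex_def)

text \<open>Linear in the decoration \<open>p\<close> placed at \<open>s\<close>; the decoration
  that \<open>F\<close> carries there is overwritten.\<close>

definition tree_at :: "('v, nat \<times> 'd) pforest \<Rightarrow> 'v \<Rightarrow> (nat \<times> 'd \<Rightarrow>\<^sub>0 'k::field) \<Rightarrow> ('d, 'k) ucp" where
  "tree_at F s p = lin (\<lambda>c. bas (iso_class (redec F s c))) p"

lemma lin_tree_at: "lin g (tree_at F s p) = lin (\<lambda>c. g (iso_class (redec F s c))) p"
  by (simp add: tree_at_def lin_lin)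

lemma tree_at_iso:
  assumes "partitioned_forest F" "iso_map h F G" "s \<in> verts F"
  shows "tree_at F s p = tree_at G (h s) p"
  unfolding tree_at_def
  using iso_class_eqI[OF _ iso_map_redec[OF assms(2,3)]] assms(1) by (intro lin_cong) simp

lemma tree_at_single:
  assumes F: "partitioned_tree F" and s: "verts F = {s}"
  shows "tree_at F s p = tree_at (one_vertex (deco F s)) () p"
proof -
  note FD = partitioned_forestD[OF partitioned_treeD[OF F]]
  have "edges F = {}" using FD(2,3) unfolding s acyclic_def by auto
  moreover have "blocks F = {{s}}"
  proof -
    have "B = {s}" if "B \<in> blocks F" for B using FD(8,9)[OF that] s by auto
    moreover have "blocks F \<noteq> {}" using FD(6) s by (auto simp: partition_on_def)
    ultimately show ?thesis by blast
  qed
  ultimately have iso: "iso_map (\<lambda>_. ()) F (one_vertex (deco F s))"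
    using s by (simp add: iso_map_def one_vertex_def bij_betw_def)
  show ?thesis by (rule tree_at_iso[OF partitioned_treeD[OF F] iso]) (simp add: s)
qed

text \<open>This and the next two lemmas rest on the same fact: the products commute with
  \<open>redec\<close>, so a linear decoration stays in place at the image of its vertex. They yield
  the closure of the span of relations under products.\<close>

lemma tree_at_mult:
  assumes "partitioned_tree F" "partitioned_tree G"
  shows "bilinear_ext basis_mult (tree_at F s p) (bas (iso_class G)) = tree_at (merge F G) (Inl s) p"
  unfolding bilinear_ext_bas lin_tree_at
  by (simp add: basis_mult_iso_class assms merge_redec tree_at_def)

lemma tree_at_bullet:
  assumes "partitioned_tree F" "partitioned_tree G" "verts G \<noteq> {}"
  shows "bilinear_ext basis_bullet (tree_at F s p) (bas (iso_class G)) =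
    (\<Sum>v\<in>verts F. tree_at (graft F v G) (Inl s) p)"
  unfolding bilinear_ext_bas lin_tree_at
  by (simp add: basis_bullet_iso_class assms graft_redec1 tree_at_def lin_fun_sum)

lemma bullet_tree_at:
  assumes "partitioned_tree F" "partitioned_tree G" "s \<in> verts F"
  shows "bilinear_ext basis_bullet (bas (iso_class G)) (tree_at F s p) =
    (\<Sum>v\<in>verts G. tree_at (graft G v F) (Inr s) p)"
proof -
  have "verts F \<noteq> {}" using assms(3) by auto
  then show ?thesis
    unfolding bilinear_ext_bas lin_tree_at
    by (simp add: basis_bullet_iso_class assms graft_redec2 tree_at_def lin_fun_sum)
qed

text \<open>Here \<open>a d\<close> is the coordinate vector of \<open>f (tau 0 d)\<close> in the family \<open>tau 0\<close>.\<close>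

definition shift :: "('d \<Rightarrow> ('d \<Rightarrow>\<^sub>0 'k)) \<Rightarrow> nat \<Rightarrow> 'd \<Rightarrow> (nat \<times> 'd \<Rightarrow>\<^sub>0 'k::field)" where
  "shift a k d = bas (Suc k, d) - lin (\<lambda>d'. bas (k, d')) (a d)"

lemma lin_shift: "lin g (shift a k d) = g (Suc k, d) - lin (\<lambda>d'. g (k, d')) (a d)"
  by (simp add: shift_def lin_diff lin_lin)

text \<open>Raising \<open>s\<close> itself raises both terms of the decoration and turns the shift
  at \<open>k\<close> into the shift at \<open>Suc k\<close>; raising another vertex leaves the
  decoration at \<open>s\<close> alone.\<close>

lemma tree_at_bullet_empty:
  assumes F: "partitioned_tree F" and s: "s \<in> verts F"
  shows "bilinear_ext basis_bullet (tree_at F s (shift a k d)) (bas (iso_class empty_forest)) =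
    tree_at F s (shift a (Suc k) d) + (\<Sum>v\<in>verts F - {s}. tree_at (raise F v) s (shift a k d))"
proof -
  have "bilinear_ext basis_bullet (tree_at F s (shift a k d)) (bas (iso_class empty_forest)) =
    (\<Sum>v\<in>verts F. lin (\<lambda>c. bas (iso_class (raise (redec F s c) v))) (shift a k d))"
    unfolding bilinear_ext_bas lin_tree_at by (simp add: basis_bullet_empty F lin_fun_sum)
  also have "\<dots> = lin (\<lambda>c. bas (iso_class (raise (redec F s c) s))) (shift a k d) +
    (\<Sum>v\<in>verts F - {s}. lin (\<lambda>c. bas (iso_class (raise (redec F s c) v))) (shift a k d))"
    using s partitioned_forestD(1)[OF partitioned_treeD[OF F]] by (simp add: sum.remove)
  also have "lin (\<lambda>c. bas (iso_class (raise (redec F s c) s))) (shift a k d) = tree_at F s (shift a (Suc k) d)"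
    by (simp add: tree_at_def lin_shift raise_redec redec_redec)
  also have "(\<Sum>v\<in>verts F - {s}. lin (\<lambda>c. bas (iso_class (raise (redec F s c) v))) (shift a k d)) =
    (\<Sum>v\<in>verts F - {s}. tree_at (raise F v) s (shift a k d))"
    by (intro sum.cong refl) (simp add: tree_at_def raise_redec redec_swap)
  finally show ?thesis .
qed

text \<open>The vertex type is fixed to \<open>nat\<close> so that the relations form one set;
  \<open>shift_relationsI\<close> supplies them for every vertex type.\<close>

definition shift_relations :: "'d set \<Rightarrow> ('d \<Rightarrow> ('d \<Rightarrow>\<^sub>0 'k)) \<Rightarrow> ('d, 'k::field) ucp set" where
  "shift_relations D a = {tree_at F s (shift a k d) | F s k d.
     dtree D (F :: (nat, nat \<times> 'd) pforest) \<and> s \<in> verts F \<and> d \<in> D}"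

lemma shift_relationsI:
  assumes "dtree D F" "s \<in> verts F" "d \<in> D"
  shows "tree_at F s (shift a k d) \<in> shift_relations D a"
proof -
  obtain h and G :: "(nat, nat \<times> 'a) pforest" where h: "iso_map h F G"
    using ex_iso_map_nat[OF dtreeD(2)[OF assms(1)]] .
  then have "h s \<in> verts G" using assms(2) by (auto simp: iso_map_def bij_betw_def)
  moreover have "tree_at F s (shift a k d) = tree_at G (h s) (shift a k d)"
    by (rule tree_at_iso[OF dtreeD(2)[OF assms(1)] h assms(2)])
  ultimately show ?thesis
    using iso_map_dtree[OF assms(1) h] assms(3) unfolding shift_relations_def by blast
qed

section \<open>\<open>UCP D\<close> as a vector space, and its ideals as subspaces\<close>

lemma UCP_simps [simp]:
  "carrier (UCP D) = {p. Poly_Mapping.keys p \<subseteq> UPT D}"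
  "mult (UCP D) = bilinear_ext basis_mult"
  "one (UCP D) = bas (iso_class empty_forest)"
  "zero (UCP D) = 0"
  "add (UCP D) = (+)"
  "smult (UCP D) = scal"
  "bullet (UCP D) = bilinear_ext basis_bullet"
  by (simp_all add: UCP_def)

lemma carrier_UCP: "carrier (UCP D) = fin.span (bas ` UPT D)"
  by (auto simp: keys_subset_span)

lemma UCP_closed: "0 \<in> carrier (UCP D)" "p \<in> carrier (UCP D) \<Longrightarrow> q \<in> carrier (UCP D) \<Longrightarrow> p + q \<in> carrier (UCP D)"
  "p \<in> carrier (UCP D) \<Longrightarrow> - p \<in> carrier (UCP D)"
  "p \<in> carrier (UCP D) \<Longrightarrow> scal c p \<in> carrier (UCP D)"
  unfolding carrier_UCP by (rule fin.span_zero fin.span_add fin.span_neg fin.span_scale; assumption)+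

lemma abelian_group_UCP: "abelian_group (UCP D)"
proof (rule abelian_groupI)
  fix x assume "x \<in> carrier (UCP D)"
  then show "\<exists>y\<in>carrier (UCP D). y \<oplus>\<^bsub>UCP D\<^esub> x = \<zero>\<^bsub>UCP D\<^esub>"
    using UCP_closed(3) by (intro bexI[of _ "- x"]) auto
qed (auto simp del: UCP_simps(1) simp: UCP_closed ac_simps)

text \<open>Submodules refer to the inverse in the additive monoid of the record; uniqueness of
  inverses identifies it with minus.\<close>

lemma a_inv_UCP: "p \<in> carrier (UCP D) \<Longrightarrow> \<ominus>\<^bsub>UCP D\<^esub> p = - p"
  using UCP_closed(3)[of p D] by (intro abelian_group.minus_equality[OF abelian_group_UCP]) auto

text \<open>Makes the calculus of spans available for the record-based notion of submodule.\<close>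

lemma submodule_UCP_iff:
  "submodule V base_field (UCP D :: ('k::field, ('d, 'k) ucp) com_prelie)
    \<longleftrightarrow> fin.subspace V \<and> V \<subseteq> carrier (UCP D :: ('k, ('d, 'k) ucp) com_prelie)"
  (is "submodule V base_field ?U \<longleftrightarrow> _")
proof
  assume "submodule V base_field ?U"
  then interpret submodule V base_field ?U .
  show "fin.subspace V \<and> V \<subseteq> carrier ?U"
    using subset one_closed m_closed smult_closed
    by (auto simp: fin.subspace_def base_field_def)
next
  assume V: "fin.subspace V \<and> V \<subseteq> carrier ?U"
  show "submodule V base_field ?U"
  proof (intro submodule.intro subgroup.intro submodule_axioms.intro)
    show "V \<subseteq> carrier (add_monoid ?U)" using V by simp
    fix x y assume "x \<in> V" "y \<in> V"
    with V show "x \<otimes>\<^bsub>add_monoid ?U\<^esub> y \<in> V" by (simp add: fin.subspace_add)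
  next
    show "\<one>\<^bsub>add_monoid ?U\<^esub> \<in> V" using V by (simp add: fin.subspace_0)
  next
    fix x assume x: "x \<in> V"
    then have "inv\<^bsub>add_monoid ?U\<^esub> x = - x" using a_inv_UCP[of x D] V by (auto simp: a_inv_def)
    with V x show "inv\<^bsub>add_monoid ?U\<^esub> x \<in> V" by (simp add: fin.subspace_neg)
  next
    fix c x assume "c \<in> carrier (base_field :: 'k ring)" "x \<in> V"
    with V show "c \<odot>\<^bsub>?U\<^esub> x \<in> V" by (simp add: fin.subspace_scale)
  qed
qed

lemma com_prelie_ideal_UCP_iff:
  "com_prelie_ideal base_field (UCP D :: ('k::field, ('d, 'k) ucp) com_prelie) I \<longleftrightarrow>
    fin.subspace I \<and> I \<subseteq> carrier (UCP D :: ('k, ('d, 'k) ucp) com_prelie) \<and>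
    (\<forall>x\<in>I. \<forall>a\<in>carrier (UCP D :: ('k, ('d, 'k) ucp) com_prelie). bilinear_ext basis_mult x a \<in> I \<and>
      bilinear_ext basis_bullet x a \<in> I \<and> bilinear_ext basis_bullet a x \<in> I)"
  unfolding com_prelie_ideal_def submodule_UCP_iff by simp

text \<open>The assumption expresses in coordinates that \<open>f\<close> sends each
  \<open>tau 0 d\<close> into \<open>V0 D\<close>; it keeps the substituted decorations inside
  \<open>D\<close>.\<close>

context
  fixes D :: "'d set" and a :: "'d \<Rightarrow> ('d \<Rightarrow>\<^sub>0 'k::field)"
  assumes a: "\<And>d. d \<in> D \<Longrightarrow> Poly_Mapping.keys (a d) \<subseteq> D"
begin

section \<open>The span of the relations is the generated ideal\<close>

lemma shift_relations_carrier: "shift_relations D a \<subseteq> carrier (UCP D)"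
proof
  fix x assume "x \<in> shift_relations D a"
  then obtain F :: "(nat, nat \<times> 'd) pforest" and s k d
    where x: "x = tree_at F s (shift a k d)" "dtree D F" "d \<in> D"
    unfolding shift_relations_def by blast
  have *: "bas (iso_class (redec F s (k, d))) \<in> fin.span (bas ` UPT D)" if "d \<in> D" for k d
    using iso_class_UPT[OF dtree_redec[OF x(2), of "(k, d)"]] that by (intro fin.span_base) auto
  show "x \<in> carrier (UCP D)"
    unfolding x(1) carrier_UCP tree_at_def lin_shift
    by (intro fin.span_diff lin_in_span *) (use a x(3) in auto)
qed

lemma com_prelie_ideal_shift_relations:
  "com_prelie_ideal base_field (UCP D) (fin.span (shift_relations D a))"
proof -
  have J: "fin.span (shift_relations D a) \<subseteq> carrier (UCP D)"
    using shift_relations_carrier fin.span_minimal unfolding carrier_UCP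
    by (metis fin.span_span fin.span_mono)
  have basis: "bilinear_ext basis_mult x y \<in> fin.span (shift_relations D a) \<and>
      bilinear_ext basis_bullet x y \<in> fin.span (shift_relations D a) \<and>
      bilinear_ext basis_bullet y x \<in> fin.span (shift_relations D a)"
    if xy: "x \<in> shift_relations D a" "y \<in> bas ` UPT D" for x y :: "('d, 'k) ucp"
  proof -
    obtain F :: "(nat, nat \<times> 'd) pforest" and s k d
      where x: "x = tree_at F s (shift a k d)" and F: "dtree D F" "s \<in> verts F" and d: "d \<in> D"
      using xy(1) unfolding shift_relations_def by blast
    obtain G :: "(nat, nat \<times> 'd) pforest" where y: "y = bas (iso_class G)" and G: "dtree D G"
      using xy(2) by (auto simp: UPT_iff)
    note T = dtreeD(1)[OF F(1)] dtreeD(1)[OF G]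
    have "bilinear_ext basis_mult x y \<in> fin.span (shift_relations D a)"
      unfolding x y tree_at_mult[OF T]
      using F G d by (intro fin.span_base shift_relationsI dtree_merge) auto
    moreover have "bilinear_ext basis_bullet y x \<in> fin.span (shift_relations D a)"
      unfolding x y bullet_tree_at[OF T F(2)]
      using F G d by (intro fin.span_sum fin.span_base shift_relationsI dtree_graft) auto
    moreover have "bilinear_ext basis_bullet x y \<in> fin.span (shift_relations D a)"
    proof (cases "verts G = {}")
      case True
      then have "iso_class G = iso_class empty_forest" using iso_class_empty_iff[OF dtreeD(2)[OF G]] by simp
      then show ?thesis
        unfolding x y
        using F d by (simp only: tree_at_bullet_empty[OF T(1) F(2)])
          (intro fin.span_add fin.span_sum; intro fin.span_base shift_relationsI dtree_raise; simp add: raise_redec)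
    next
      case False
      show ?thesis
        unfolding x y tree_at_bullet[OF T False]
        using F G d by (intro fin.span_sum fin.span_base shift_relationsI dtree_graft) auto
    qed
    ultimately show ?thesis by simp
  qed
  show ?thesis
    unfolding com_prelie_ideal_UCP_iff
  proof (intro conjI ballI)
    show "fin.subspace (fin.span (shift_relations D a))" by (rule fin.subspace_span)
    fix x y :: "('d, 'k) ucp"
    assume "x \<in> fin.span (shift_relations D a)" "y \<in> carrier (UCP D :: ('k, ('d, 'k) ucp) com_prelie)"
    then have xy: "x \<in> fin.span (shift_relations D a)" "y \<in> fin.span (bas ` UPT D)"
      by (simp_all only: carrier_UCP)
    show "bilinear_ext basis_mult x y \<in> fin.span (shift_relations D a)"
      "bilinear_ext basis_bullet x y \<in> fin.span (shift_relations D a)"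
      "bilinear_ext basis_bullet y x \<in> fin.span (shift_relations D a)"
      using basis xy by (blast intro: bilinear_ext_span)+
  qed (rule J)
qed

lemma card_Inl_Inr: "finite A \<Longrightarrow> finite B \<Longrightarrow> card (Inl ` A \<union> Inr ` B) = card A + card B"
  by (simp flip: Plus_def add: card_Plus)

text \<open>An arbitrary ideal containing the generators is considered, because the generated ideal
  is the intersection of all of these. The outer induction varies the tree and its marked vertex and
  keeps \<open>k\<close> and \<open>d\<close> fixed.\<close>

lemma shift_relation_in_ideal:
  fixes F :: "(nat, nat \<times> 'd) pforest"
  assumes I: "com_prelie_ideal base_field (UCP D) I"
    and gen: "\<And>d. d \<in> D \<Longrightarrow> tau 1 d - lin (tau 0) (a d) \<in> I"
    and "dtree D F" "s \<in> verts F" and d: "d \<in> D"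
  shows "tree_at F s (shift a k d) \<in> I"
  using assms(3,4)
proof (induction F arbitrary: s rule: wf_induct_rule[OF wf_measures[of "[\<lambda>F. card (verts F), \<lambda>F. card (rootkids F)]"]])
  case (1 F)
  note F = \<open>dtree D F\<close> and s = \<open>s \<in> verts F\<close>
  note FT = dtreeD(1)[OF F] and FF = dtreeD(2)[OF F]
  have ideal: "bilinear_ext basis_mult x y \<in> I" "bilinear_ext basis_bullet x y \<in> I" "bilinear_ext basis_bullet y x \<in> I"
    if "x \<in> I" "y \<in> carrier (UCP D :: ('k, ('d, 'k) ucp) com_prelie)" for x y
    using I that unfolding com_prelie_ideal_UCP_iff by blast+
  have sub: "fin.subspace I" using I unfolding com_prelie_ideal_UCP_iff by blast
  have bas: "bas (iso_class G) \<in> carrier (UCP D :: ('k, ('d, 'k) ucp) com_prelie)"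
    if "dtree D G" for G :: "('w, nat \<times> 'd) pforest"
    unfolding carrier_UCP using iso_class_UPT[OF that] by (intro fin.span_base) auto
  \<comment> \<open>The induction runs over forests on \<open>nat\<close>, whereas grafts live on
    sum types; a copy on \<open>nat\<close> with the same two measures bridges the gap.\<close>
  have IH: "tree_at G t (shift a k d) \<in> I"
    if G: "dtree D G" "t \<in> verts G"
      "card (verts G) < card (verts F) \<or> card (verts G) = card (verts F) \<and> card (rootkids G) < card (rootkids F)"
    for G :: "('w, nat \<times> 'd) pforest" and t
  proof -
    note G' = dtreeD(2)[OF G(1)]
    obtain h and G' :: "(nat, nat \<times> 'd) pforest" where h: "iso_map h G G'" using ex_iso_map_nat[OF G'] .
    have "h t \<in> verts G'" using h G(2) by (auto simp: iso_map_def bij_betw_def)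
    moreover have "(G', F) \<in> measures [\<lambda>F. card (verts F), \<lambda>F. card (rootkids F)]"
      using G(3) iso_map_card[OF h] iso_map_rootkids[OF G' h] by auto
    ultimately show ?thesis
      unfolding tree_at_iso[OF G' h G(2)] using "1.IH" iso_map_dtree[OF G(1) h] by blast
  qed
  show ?case
    using FT s
  proof (cases rule: partitioned_tree_decompose)
    case single
    define c where "c = deco F s"
    have "tree_at (one_vertex c) () (shift a k d) \<in> I"
    proof (induction k)
      case 0
      then show ?case
        using gen[OF d] by (simp add: tree_at_def lin_shift redec_one_vertex tau_def[abs_def])
    next
      case (Suc k)
      have "bas (iso_class empty_forest) \<in> carrier (UCP D :: ('k, ('d, 'k) ucp) com_prelie)"
        by (rule bas) (simp add: dtree_def partitioned_tree_empty_forest, simp add: empty_forest_def)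
      \<comment> \<open>There is no vertex besides the marked one, so the second sum of
        \<open>tree_at_bullet_empty\<close> is empty.\<close>
      from ideal(2)[OF Suc this] show ?case
        by (subst (asm) tree_at_bullet_empty[OF partitioned_tree_one_vertex]) (simp_all add: one_vertex_def)
    qed
    then show ?thesis
      by (simp add: tree_at_single[OF FT single] c_def)
  next
    case (merge G H h s')
    \<comment> \<open>The inverse isomorphism carries the condition on decorations from
      \<open>F\<close> back to the two factors.\<close>
    have "iso_map (inv_into (verts (merge G H)) h) F (merge G H)"
      using merge partitioned_tree_merge[OF merge(1,2)] by (intro iso_map_inv) (auto dest: partitioned_treeD)
    from iso_map_dtree[OF F this] have "dtree D (merge G H)" .
    then have GH: "dtree D G" "dtree D H"
      using merge(1,2) by (simp_all add: dtree_def ball_Un) (simp_all add: merge_def)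
    have "card (verts G) < card (verts F)"
      using iso_map_card[OF merge(5)] merge(3) partitioned_forestD(1)[OF dtreeD(2)[OF GH(1)]]
        partitioned_forestD(1)[OF dtreeD(2)[OF GH(2)]]
      by (simp add: card_Inl_Inr card_gt_0_iff)
    then have "tree_at G s' (shift a k d) \<in> I" using IH[OF GH(1) merge(4)] by blast
    from ideal(1)[OF this bas[OF GH(2)]]
    have "tree_at (merge G H) (Inl s') (shift a k d) \<in> I"
      unfolding tree_at_mult[OF merge(1,2)] .
    then show ?thesis
      using tree_at_iso[OF partitioned_treeD[OF partitioned_tree_merge[OF merge(1,2)]] merge(5), of "Inl s'" "shift a k d"]
        merge(4,6) by simp
  next
    case (graft G H h r s')
    have r: "r \<in> verts G" using graft(4) roots_subset[of G] by auto
    note GHT = partitioned_tree_graft[OF graft(1,2) r]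
    have "iso_map (inv_into (verts (graft G r H)) h) F (graft G r H)"
      using graft GHT by (intro iso_map_inv) (auto dest: partitioned_treeD)
    from iso_map_dtree[OF F this] have "dtree D (graft G r H)" .
    then have GH: "dtree D G" "dtree D H"
      using graft(1,2) by (simp_all add: dtree_def ball_Un) (simp_all add: graft_def)
    have fin: "finite (verts G)" "finite (verts H)"
      using partitioned_forestD(1) dtreeD(2) GH by blast+
    have card: "card (verts F) = card (verts G) + card (verts H)"
      using iso_map_card[OF graft(6)] fin by (simp add: card_Inl_Inr)
    moreover have "card (verts G) > 0" "card (verts H) > 0"
      using r graft(3) fin by (auto simp: card_gt_0_iff)
    ultimately have less: "card (verts G) < card (verts F)" "card (verts H) < card (verts F)" by auto
    have other: "tree_at (graft G v H) s' (shift a k d) \<in> I" if v: "v \<in> verts G - {r}" for v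
    proof (rule IH)
      show "dtree D (graft G v H)" using v by (intro dtree_graft[OF GH]) simp
      show "s' \<in> verts (graft G v H)" using graft(5) by simp
      have "card (rootkids (graft G v H)) < card (rootkids (graft G r H))"
        using v by (intro rootkids_graft_less graft) auto
      also have "card (rootkids (graft G r H)) = card (rootkids F)"
        using iso_map_rootkids[OF partitioned_treeD[OF GHT] graft(6)] by simp
      finally show "card (verts (graft G v H)) < card (verts F) \<or>
          card (verts (graft G v H)) = card (verts F) \<and> card (rootkids (graft G v H)) < card (rootkids F)"
        using card fin by (simp add: card_Inl_Inr)
    qed
    \<comment> \<open>The sum over all vertices is a pre-Lie product with a factor in \<open>I\<close>; the summands other than
      the one at \<open>r\<close> have a root with fewer children.\<close>
    have "(\<Sum>v\<in>verts G. tree_at (graft G v H) s' (shift a k d)) \<in> I"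
    proof (cases s')
      case (Inl t)
      then have t: "t \<in> verts G" using graft(5) by auto
      have "tree_at G t (shift a k d) \<in> I" using IH[OF GH(1) t] less by blast
      from ideal(2)[OF this bas[OF GH(2)]] show ?thesis
        unfolding tree_at_bullet[OF graft(1-3)] Inl .
    next
      case (Inr t)
      then have t: "t \<in> verts H" using graft(5) by auto
      have "tree_at H t (shift a k d) \<in> I" using IH[OF GH(2) t] less by blast
      from ideal(3)[OF this bas[OF GH(1)]] show ?thesis
        unfolding bullet_tree_at[OF graft(2,1) t] Inr .
    qed
    moreover have "(\<Sum>v\<in>verts G - {r}. tree_at (graft G v H) s' (shift a k d)) \<in> I"
      by (rule fin.subspace_sum[OF sub other])
    ultimately have "tree_at (graft G r H) s' (shift a k d) \<in> I"
      using fin.subspace_diff[OF sub] fin(1) r by (fastforce simp: sum.remove)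
    then show ?thesis
      using tree_at_iso[OF partitioned_treeD[OF GHT] graft(6,5), of "shift a k d"] graft(7) by simp
  qed
qed

lemma ideal_gen_eq_span:
  "com_prelie_ideal_gen base_field (UCP D) {tau 1 d - lin (tau 0) (a d) | d. d \<in> D} =
    fin.span (shift_relations D a)"
proof
  have "tau 1 d - lin (tau 0) (a d) \<in> shift_relations D a" if "d \<in> D" for d
  proof -
    \<comment> \<open>Each generator is the relation with \<open>k = 0\<close> on a one-vertex
      tree.\<close>
    have "tree_at (one_vertex (0, d)) () (shift a 0 d) \<in> shift_relations D a"
      using that by (intro shift_relationsI dtree_one_vertex) (simp_all add: one_vertex_def)
    then show ?thesis by (simp add: tree_at_def lin_shift redec_one_vertex tau_def[abs_def])
  qed
  then have "{tau 1 d - lin (tau 0) (a d) | d. d \<in> D} \<subseteq> fin.span (shift_relations D a)"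
    by (auto intro: fin.span_base)
  then show "com_prelie_ideal_gen base_field (UCP D) {tau 1 d - lin (tau 0) (a d) | d. d \<in> D}
      \<subseteq> fin.span (shift_relations D a)"
    unfolding com_prelie_ideal_gen_def using com_prelie_ideal_shift_relations by blast
  have "fin.span (shift_relations D a) \<subseteq> I"
    if I: "com_prelie_ideal base_field (UCP D) I" "{tau 1 d - lin (tau 0) (a d) | d. d \<in> D} \<subseteq> I" for I
  proof (rule fin.span_minimal)
    show "shift_relations D a \<subseteq> I"
      unfolding shift_relations_def using shift_relation_in_ideal[OF I(1)] I(2) by blast
    show "fin.subspace I" using I(1) unfolding com_prelie_ideal_UCP_iff by blast
  qed
  then show "fin.span (shift_relations D a)
      \<subseteq> com_prelie_ideal_gen base_field (UCP D) {tau 1 d - lin (tau 0) (a d) | d. d \<in> D}"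
    unfolding com_prelie_ideal_gen_def by blast
qed

end

section \<open>The reduction map\<close>

definition recolor :: "('v, nat \<times> 'd) pforest \<Rightarrow> ('v \<Rightarrow> 'd) \<Rightarrow> ('v, nat \<times> 'd) pforest" where
  "recolor F \<sigma> = F\<lparr>deco := (\<lambda>x. (0, \<sigma> x))\<rparr>"

lemma recolor_redec: "recolor (redec F s c) \<sigma> = recolor F \<sigma>"
  by (simp add: recolor_def redec_def)

lemma partitioned_forest_recolor: "partitioned_forest F \<Longrightarrow> partitioned_forest (recolor F \<sigma>)"
  by (simp add: partitioned_forest_def rooted_forest_def roots_def recolor_def)

lemma iso_class_recolor:
  assumes F: "partitioned_forest F" and h: "iso_map h F G" and eq: "\<And>x. x \<in> verts F \<Longrightarrow> \<tau> (h x) = \<sigma> x"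
  shows "iso_class (recolor F \<sigma>) = iso_class (recolor G \<tau>)"
proof (rule iso_class_eqI)
  show "iso_map h (recolor F \<sigma>) (recolor G \<tau>)"
    using h eq by (simp add: iso_map_def recolor_def)
qed (rule partitioned_forest_recolor[OF F])

text \<open>The coordinates of f^k(d). Applying \<open>a\<close> first matches the relation, which
  exchanges (k + 1, d) for (k, f(d)).\<close>

primrec iter :: "('d \<Rightarrow> ('d \<Rightarrow>\<^sub>0 'k::field)) \<Rightarrow> nat \<Rightarrow> 'd \<Rightarrow> ('d \<Rightarrow>\<^sub>0 'k)" where
  "iter a 0 d = bas d"
| "iter a (Suc k) d = lin (iter a k) (a d)"

text \<open>Each decoration \<open>(k, d)\<close> is replaced by \<open>f\<^sup>k(d)\<close>, multilinearly in the vertices.\<close>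

definition reduce :: "('d \<Rightarrow> ('d \<Rightarrow>\<^sub>0 'k::field)) \<Rightarrow> ('v, nat \<times> 'd) pforest \<Rightarrow> ('d, 'k) ucp" where
  "reduce a F = (\<Sum>\<sigma>\<in>PiE (verts F) (\<lambda>v. Poly_Mapping.keys (case_prod (iter a) (deco F v))).
     scal (\<Prod>v\<in>verts F. Poly_Mapping.lookup (case_prod (iter a) (deco F v)) (\<sigma> v))
       (bas (iso_class (recolor F \<sigma>))))"

text \<open>Colourings are transported along the isomorphism; \<open>restrict\<close> keeps them
  extensional, so that this is a bijection between the two index sets.\<close>

lemma reduce_iso:
  assumes F: "partitioned_forest F" and h: "iso_map h F G"
  shows "reduce a F = reduce a G"
proof -
  let ?N = "\<lambda>F v. case_prod (iter a) (deco F v)"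
  let ?k = "inv_into (verts F) h"
  have b: "bij_betw h (verts F) (verts G)" and d: "\<And>x. x \<in> verts F \<Longrightarrow> deco G (h x) = deco F x"
    using h by (auto simp: iso_map_def)
  have hk: "h (?k y) = y" "?k y \<in> verts F" if "y \<in> verts G" for y
    using b that by (auto simp: bij_betw_def f_inv_into_f inv_into_into)
  have kh: "?k (h x) = x" "h x \<in> verts G" if "x \<in> verts F" for x
    using b that by (auto simp: bij_betw_def)
  have d': "deco F (?k y) = deco G y" if "y \<in> verts G" for y
    using d[OF hk(2)[OF that]] hk(1)[OF that] by simp
  show ?thesis
    unfolding reduce_def
  proof (rule sum.reindex_bij_witness[where j = "\<lambda>\<sigma>. restrict (\<sigma> \<circ> ?k) (verts G)"
        and i = "\<lambda>\<tau>. restrict (\<tau> \<circ> h) (verts F)"])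
    fix \<sigma> assume \<sigma>: "\<sigma> \<in> PiE (verts F) (\<lambda>v. Poly_Mapping.keys (?N F v))"
    show "restrict (restrict (\<sigma> \<circ> ?k) (verts G) \<circ> h) (verts F) = \<sigma>"
      using \<sigma> kh by (auto simp: fun_eq_iff restrict_def PiE_def extensional_def)
    show "restrict (\<sigma> \<circ> ?k) (verts G) \<in> PiE (verts G) (\<lambda>v. Poly_Mapping.keys (?N G v))"
      using PiE_mem[OF \<sigma>] hk(2) d' by fastforce
    have "(\<Prod>v\<in>verts F. Poly_Mapping.lookup (?N F v) (\<sigma> v)) =
        (\<Prod>v\<in>verts G. Poly_Mapping.lookup (?N G v) (restrict (\<sigma> \<circ> ?k) (verts G) v))"
      by (rule prod.reindex_bij_witness[where i = ?k and j = h]) (simp_all add: kh hk d)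
    moreover have "iso_class (recolor F \<sigma>) = iso_class (recolor G (restrict (\<sigma> \<circ> ?k) (verts G)))"
      by (rule iso_class_recolor[OF F h]) (simp add: kh)
    ultimately show "scal (\<Prod>v\<in>verts G. Poly_Mapping.lookup (?N G v) (restrict (\<sigma> \<circ> ?k) (verts G) v))
        (bas (iso_class (recolor G (restrict (\<sigma> \<circ> ?k) (verts G))))) =
      scal (\<Prod>v\<in>verts F. Poly_Mapping.lookup (?N F v) (\<sigma> v)) (bas (iso_class (recolor F \<sigma>)))" by simp
  next
    fix \<tau> assume \<tau>: "\<tau> \<in> PiE (verts G) (\<lambda>v. Poly_Mapping.keys (?N G v))"
    show "restrict (restrict (\<tau> \<circ> h) (verts F) \<circ> ?k) (verts G) = \<tau>"
      using \<tau> hk by (auto simp: fun_eq_iff restrict_def PiE_def extensional_def)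
    show "restrict (\<tau> \<circ> h) (verts F) \<in> PiE (verts F) (\<lambda>v. Poly_Mapping.keys (?N F v))"
      using PiE_mem[OF \<tau>] kh(2) d by fastforce
  qed
qed

text \<open>Multilinearity in one vertex: a colouring consists of a colour of \<open>s\<close> and a
  colouring of the other vertices, and only the coefficient of the former depends on
  \<open>c\<close>. Hence one \<open>g\<close> serves all \<open>c\<close>.\<close>

lemma reduce_redec:
  fixes a :: "'d \<Rightarrow> ('d \<Rightarrow>\<^sub>0 'k::field)"
  assumes F: "partitioned_forest F" and s: "s \<in> verts F"
  obtains g where "\<And>c. reduce a (redec F s c) = lin g (case_prod (iter a) c)"
proof
  fix c
  let ?N = "\<lambda>c. case_prod (iter a) c"
  let ?V = "verts F - {s}"
  let ?P = "PiE ?V (\<lambda>v. Poly_Mapping.keys (?N (deco F v)))"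
  \<comment> \<open>The contribution of all colourings giving \<open>s\<close> the colour
    \<open>x\<close>, with the coefficient at \<open>s\<close> left out.\<close>
  let ?g = "\<lambda>x. \<Sum>\<sigma>\<in>?P. scal (\<Prod>v\<in>?V. Poly_Mapping.lookup (?N (deco F v)) (\<sigma> v))
       (bas (iso_class (recolor F (\<sigma>(s := x)))) :: ('d, 'k) ucp)"
  let ?D = "(deco F)(s := c)"
  have V: "verts F = insert s ?V" "s \<notin> ?V" using s by auto
  have fin: "finite ?V" using partitioned_forestD(1)[OF F] by simp
  have P: "PiE ?V (\<lambda>v. Poly_Mapping.keys (?N (?D v))) = ?P"
    by (rule PiE_cong) simp
  have inj: "inj_on (\<lambda>(y, g). g(s := y)) (Poly_Mapping.keys (?N c) \<times> ?P)"
    using inj_combinator[OF V(2), of "\<lambda>v. Poly_Mapping.keys (?N (?D v))"] unfolding P by simp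
  have "reduce a (redec F s c) =
    (\<Sum>\<sigma>\<in>PiE (insert s ?V) (\<lambda>v. Poly_Mapping.keys (?N (?D v))).
     scal (\<Prod>v\<in>insert s ?V. Poly_Mapping.lookup (?N (?D v)) (\<sigma> v)) (bas (iso_class (recolor F \<sigma>))))"
    unfolding reduce_def recolor_redec redec_simps V(1)[symmetric] ..
  also have "PiE (insert s ?V) (\<lambda>v. Poly_Mapping.keys (?N (?D v))) =
      (\<lambda>(y, g). g(s := y)) ` (Poly_Mapping.keys (?N c) \<times> ?P)"
    unfolding PiE_insert_eq P by simp
  also have "(\<Sum>\<sigma>\<in>(\<lambda>(y, g). g(s := y)) ` (Poly_Mapping.keys (?N c) \<times> ?P).
     scal (\<Prod>v\<in>insert s ?V. Poly_Mapping.lookup (?N (?D v)) (\<sigma> v)) (bas (iso_class (recolor F \<sigma>)))) =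
    (\<Sum>(y, g)\<in>Poly_Mapping.keys (?N c) \<times> ?P.
     scal (\<Prod>v\<in>insert s ?V. Poly_Mapping.lookup (?N (?D v)) ((g(s := y)) v)) (bas (iso_class (recolor F (g(s := y))))))"
    unfolding sum.reindex[OF inj] comp_def by (intro sum.cong refl) (simp only: split_beta)
  also have "\<dots> = (\<Sum>(y, g)\<in>Poly_Mapping.keys (?N c) \<times> ?P. scal (Poly_Mapping.lookup (?N c) y)
     (scal (\<Prod>v\<in>?V. Poly_Mapping.lookup (?N (deco F v)) (g v)) (bas (iso_class (recolor F (g(s := y)))))))"
  proof (intro sum.cong refl, clarify)
    fix y g
    have "(\<Prod>v\<in>?V. Poly_Mapping.lookup (?N (?D v)) ((g(s := y)) v)) = (\<Prod>v\<in>?V. Poly_Mapping.lookup (?N (deco F v)) (g v))"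
      by (intro prod.cong) auto
    then show "scal (\<Prod>v\<in>insert s ?V. Poly_Mapping.lookup (?N (?D v)) ((g(s := y)) v)) (bas (iso_class (recolor F (g(s := y))))) =
      scal (Poly_Mapping.lookup (?N c) y)
     (scal (\<Prod>v\<in>?V. Poly_Mapping.lookup (?N (deco F v)) (g v)) (bas (iso_class (recolor F (g(s := y))))))"
      using fin by (subst prod.insert) auto
  qed
  also have "\<dots> = lin ?g (?N c)"
    by (simp add: lin_def fin.scale_sum_right sum.cartesian_product)
  finally show "reduce a (redec F s c) = lin ?g (?N c)" .
qed

text \<open>With the other vertices absorbed into \<open>g\<close>, the two terms of the shift give
  \<open>g\<close> extended to f^(k+1)(d) and to f^k(f(d)), which agree.\<close>

lemma reduce_tree_at:
  assumes F: "partitioned_forest F" and s: "s \<in> verts F"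
  shows "lin (\<lambda>T. reduce a (rep T)) (tree_at F s (shift a k d)) = 0"
proof -
  obtain g where g: "\<And>c. reduce a (redec F s c) = lin g (case_prod (iter a) c)"
    using reduce_redec[OF F s] by blast
  have r: "reduce a (rep (iso_class (redec F s c))) = lin g (case_prod (iter a) c)" for c
  proof -
    obtain h where "iso_map h (redec F s c) (rep (iso_class (redec F s c)))"
      using iso_map_rep[of "redec F s c"] F by auto
    from reduce_iso[OF _ this, of a] F g show ?thesis by simp
  qed
  have "lin g (lin (iter a k) (a d)) - lin (\<lambda>d'. lin g (iter a k d')) (a d) = 0"
    by (simp add: lin_lin)
  then show ?thesis
    by (simp add: lin_tree_at lin_shift r)
qed

lemma UPT'_iff: "T \<in> UPT' D \<longleftrightarrow> (\<exists>F :: (nat, nat \<times> 'd) pforest. T = iso_class F \<and> dtree D F \<and> (\<forall>s\<in>verts F. fst (deco F s) = 0))"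
  by (auto simp: UPT'_def dtree_def mem_Times_iff)

lemma UPT'_subset: "UPT' D \<subseteq> UPT D"
  by (auto simp: UPT'_iff UPT_iff)

text \<open>Since f^0(d) = d, every vertex admits exactly one colour, its own, with coefficient
  1.\<close>

lemma reduce_UPT':
  assumes "T \<in> UPT' D"
  shows "reduce a (rep T) = bas T"
proof -
  obtain F :: "(nat, nat \<times> 'a) pforest" where T: "T = iso_class F" and F: "dtree D F"
    and z: "\<forall>s\<in>verts F. fst (deco F s) = 0"
    using assms by (auto simp: UPT'_iff)
  note F' = dtreeD(2)[OF F]
  define \<sigma> where "\<sigma> = restrict (snd \<circ> deco F) (verts F)"
  have N: "case_prod (iter a) (deco F v) = bas (\<sigma> v)" if "v \<in> verts F" for v
    using z that by (cases "deco F v") (auto simp: \<sigma>_def)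
  have "PiE (verts F) (\<lambda>v. Poly_Mapping.keys (case_prod (iter a) (deco F v))) = PiE (verts F) (\<lambda>v. {\<sigma> v})"
    by (rule PiE_cong) (simp add: N)
  also have "\<dots> = {\<sigma>}" by (rule PiE_singleton) (simp only: \<sigma>_def restrict_extensional)
  finally have "reduce a F = scal (\<Prod>v\<in>verts F. 1) (bas (iso_class (recolor F \<sigma>)))"
    by (simp add: reduce_def N)
  also have iso: "iso_map (\<lambda>x. x) F (recolor F \<sigma>)"
    using iso_map_id[of F] z by (auto simp: iso_map_def recolor_def \<sigma>_def prod_eq_iff)
  then have "iso_class (recolor F \<sigma>) = T"
    using iso_class_eqI[OF F' iso] T by simp
  finally have "reduce a F = bas T" by simp
  moreover obtain h where "iso_map h F (rep T)" using iso_map_rep[OF F'] T by blast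
  ultimately show ?thesis using reduce_iso[OF F'] by metis
qed

section \<open>Independence and spanning modulo the relations\<close>

lemma UPT'_independent:
  assumes I: "(\<Sum>T\<in>X. scal (c T) (bas T)) \<in> fin.span (shift_relations D a)"
    and X: "finite X" "X \<subseteq> UPT' D" and T: "T \<in> X"
  shows "c T = 0"
proof -
  let ?R = "lin (\<lambda>T. reduce a (rep T))"
  have zero: "?R x = 0" if "x \<in> fin.span (shift_relations D a)" for x
    using that
  proof (induction rule: fin.span_induct_alt)
    case base
    then show ?case by simp
  next
    case (step c x y)
    have "?R x = 0"
      using step(1) unfolding shift_relations_def by (auto simp: reduce_tree_at dtreeD(2))
    with step show ?case by (simp add: lin_add lin_scal)
  qed
  have "0 = (\<Sum>T\<in>X. scal (c T) (?R (bas T)))"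
    using zero[OF I] by (simp only: lin_sum lin_scal)
  also have "\<dots> = (\<Sum>T\<in>X. Poly_Mapping.single T (c T))"
    by (intro sum.cong refl) (simp add: reduce_UPT'[OF subsetD[OF X(2)]])
  finally have "0 = Poly_Mapping.lookup (\<Sum>T\<in>X. Poly_Mapping.single T (c T)) T"
    by (metis lookup_zero)
  also have "\<dots> = c T"
    using X T by (simp add: lookup_sum lookup_single when_def)
  finally show ?thesis by simp
qed

text \<open>Induction on the sum of the integer decorations: one relation trades a decoration
  \<open>(Suc k, d)\<close> for a combination of decorations \<open>(k, d')\<close>, with
  \<open>d'\<close> again in \<open>D\<close>.\<close>

lemma UPT'_spanning:
  fixes a :: "'d \<Rightarrow> ('d \<Rightarrow>\<^sub>0 'k::field)"
  assumes a: "\<And>d. d \<in> D \<Longrightarrow> Poly_Mapping.keys (a d) \<subseteq> D"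
    and F: "dtree D (F :: (nat, nat \<times> 'd) pforest)"
  shows "bas (iso_class F) \<in> fin.span (bas ` UPT' D \<union> shift_relations D a)"
  using F
proof (induction "\<Sum>s\<in>verts F. fst (deco F s)" arbitrary: F rule: less_induct)
  case less
  note fin = partitioned_forestD(1)[OF dtreeD(2)[OF less.prems]]
  show ?case
  proof (cases "\<forall>s\<in>verts F. fst (deco F s) = 0")
    case True
    then have "iso_class F \<in> UPT' D" using less.prems by (auto simp: UPT'_iff)
    then show ?thesis by (intro fin.span_base) auto
  next
    case False
    then obtain s k d where s: "s \<in> verts F" "deco F s = (Suc k, d)"
      by (metis not0_implies_Suc prod.collapse)
    have d: "d \<in> D" using less.prems s by (force simp: dtree_def)
    \<comment> \<open>The leading term of the relation is \<open>F\<close> itself, since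
      \<open>redec\<close> with the decoration already present changes nothing.\<close>
    have "bas (iso_class F) = tree_at F s (shift a k d) + lin (\<lambda>d'. bas (iso_class (redec F s (k, d')))) (a d)"
      by (simp add: tree_at_def lin_shift flip: s(2))
    moreover have "tree_at F s (shift a k d) \<in> fin.span (bas ` UPT' D \<union> shift_relations D a)"
      using shift_relationsI[OF less.prems s(1) d] by (intro fin.span_base) auto
    moreover have "lin (\<lambda>d'. bas (iso_class (redec F s (k, d')))) (a d)
        \<in> fin.span (bas ` UPT' D \<union> shift_relations D a)"
    proof (rule lin_in_span, rule less.hyps)
      fix d' assume "d' \<in> Poly_Mapping.keys (a d)"
      then show "dtree D (redec F s (k, d'))" using a[OF d] by (intro dtree_redec less.prems) auto
      have "(\<Sum>v\<in>verts F - {s}. fst (((deco F)(s := (k, d'))) v)) = (\<Sum>v\<in>verts F - {s}. fst (deco F v))"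
        by (intro sum.cong) auto
      then show "(\<Sum>v\<in>verts (redec F s (k, d')). fst (deco (redec F s (k, d')) v)) < (\<Sum>v\<in>verts F. fst (deco F v))"
        using s fin by (simp add: sum.remove)
    qed
    ultimately show ?thesis by (simp add: fin.span_add)
  qed
qed

section \<open>The quotient\<close>

context
  fixes D :: "'d set" and I :: "('d, 'k::field) ucp set"
  assumes I: "com_prelie_ideal base_field (UCP D) I"
begin

lemma subspace_I: "fin.subspace I" and I_carrier: "I \<subseteq> carrier (UCP D)"
  using I by (simp_all only: com_prelie_ideal_UCP_iff)

lemma coset_mem: "y \<in> I +>\<^bsub>UCP D\<^esub> x \<longleftrightarrow> y - x \<in> I"
  unfolding a_r_coset_def' by (auto simp: diff_eq_eq) (metis diff_add_cancel)

lemma coset_eq_iff: "I +>\<^bsub>UCP D\<^esub> x = I +>\<^bsub>UCP D\<^esub> y \<longleftrightarrow> x - y \<in> I"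
proof
  assume "I +>\<^bsub>UCP D\<^esub> x = I +>\<^bsub>UCP D\<^esub> y"
  moreover have "x \<in> I +>\<^bsub>UCP D\<^esub> x" using fin.subspace_0[OF subspace_I] by (simp add: coset_mem)
  ultimately show "x - y \<in> I" by (simp add: coset_mem)
next
  assume xy: "x - y \<in> I"
  have "z - x \<in> I \<longleftrightarrow> z - y \<in> I" for z
    using fin.subspace_add[OF subspace_I _ xy, of "z - x"] fin.subspace_diff[OF subspace_I _ xy, of "z - y"]
    by auto
  then show "I +>\<^bsub>UCP D\<^esub> x = I +>\<^bsub>UCP D\<^esub> y" by (auto simp: coset_mem)
qed

lemma coset_zero: "I +>\<^bsub>UCP D\<^esub> 0 = I"
  by (auto simp: coset_mem)

lemma coset_add: "(I +>\<^bsub>UCP D\<^esub> x) <+>\<^bsub>UCP D\<^esub> (I +>\<^bsub>UCP D\<^esub> y) = I +>\<^bsub>UCP D\<^esub> (x + y)"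
proof (intro equalityI subsetI)
  fix z assume "z \<in> (I +>\<^bsub>UCP D\<^esub> x) <+>\<^bsub>UCP D\<^esub> (I +>\<^bsub>UCP D\<^esub> y)"
  then obtain u v where uv: "z = u + v" "u - x \<in> I" "v - y \<in> I"
    by (auto simp: set_add_def' coset_mem)
  have *: "z - (x + y) = (u - x) + (v - y)" by (simp add: uv)
  show "z \<in> I +>\<^bsub>UCP D\<^esub> (x + y)"
    unfolding coset_mem * by (rule fin.subspace_add[OF subspace_I uv(2,3)])
next
  fix z assume "z \<in> I +>\<^bsub>UCP D\<^esub> (x + y)"
  then have "(z - y) - x \<in> I" "y - y \<in> I" "z = (z - y) + y"
    using fin.subspace_0[OF subspace_I] by (simp_all add: coset_mem algebra_simps)
  then show "z \<in> (I +>\<^bsub>UCP D\<^esub> x) <+>\<^bsub>UCP D\<^esub> (I +>\<^bsub>UCP D\<^esub> y)"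
    unfolding set_add_def' coset_mem[symmetric] UCP_simps by blast
qed

lemma carrier_quot: "carrier (com_prelie_quot (UCP D) I) = (\<lambda>x. I +>\<^bsub>UCP D\<^esub> x) ` carrier (UCP D)"
  by (auto simp: com_prelie_quot_def A_RCOSETS_def')

text \<open>The quotient operation is a union over all representatives; the cosets in this union are
  equal because \<open>I\<close> is a subspace.\<close>

lemma quot_smult: "c \<odot>\<^bsub>com_prelie_quot (UCP D) I\<^esub> (I +>\<^bsub>UCP D\<^esub> x) = I +>\<^bsub>UCP D\<^esub> scal c x"
proof -
  have "I +>\<^bsub>UCP D\<^esub> scal c y = I +>\<^bsub>UCP D\<^esub> scal c x" if "y \<in> I +>\<^bsub>UCP D\<^esub> x" for y
    using that fin.subspace_scale[OF subspace_I, of "y - x" c]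
    by (simp add: coset_eq_iff coset_mem fin.scale_right_diff_distrib)
  then have "(\<Union>y\<in>I +>\<^bsub>UCP D\<^esub> x. I +>\<^bsub>UCP D\<^esub> scal c y) = (\<Union>y\<in>I +>\<^bsub>UCP D\<^esub> x. I +>\<^bsub>UCP D\<^esub> scal c x)"
    by (rule SUP_cong[OF refl])
  moreover have "x \<in> I +>\<^bsub>UCP D\<^esub> x" using fin.subspace_0[OF subspace_I] by (simp add: coset_mem)
  \<comment> \<open>A union of equal cosets is that coset only over a nonempty index set.\<close>
  then have "I +>\<^bsub>UCP D\<^esub> x \<noteq> {}" by blast
  ultimately show ?thesis by (simp add: com_prelie_quot_def)
qed

lemma quot_bullet:
  assumes x: "x \<in> carrier (UCP D)" and y: "y \<in> carrier (UCP D)"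
  shows "(I +>\<^bsub>UCP D\<^esub> x) \<bullet>\<^bsub>com_prelie_quot (UCP D) I\<^esub> (I +>\<^bsub>UCP D\<^esub> y)
    = I +>\<^bsub>UCP D\<^esub> bilinear_ext basis_bullet x y"
proof -
  let ?b = "bilinear_ext basis_bullet :: ('d, 'k) ucp \<Rightarrow> ('d, 'k) ucp \<Rightarrow> ('d, 'k) ucp"
  have "I +>\<^bsub>UCP D\<^esub> ?b x' y' = I +>\<^bsub>UCP D\<^esub> ?b x y"
    if "x' \<in> I +>\<^bsub>UCP D\<^esub> x" "y' \<in> I +>\<^bsub>UCP D\<^esub> y" for x' y'
  proof -
    have d: "x' - x \<in> I" "y' - y \<in> I" using that by (simp_all add: coset_mem)
    \<comment> \<open>The ideal absorbs products with elements of the carrier, so the representative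
      \<open>x'\<close> must be shown to lie there.\<close>
    then have "x' - x \<in> carrier (UCP D)" using I_carrier by blast
    then have "(x' - x) + x \<in> carrier (UCP D)" using x by (rule UCP_closed(2))
    then have x': "x' \<in> carrier (UCP D)" by simp
    have "?b (x' - x) y \<in> I" "?b x' (y' - y) \<in> I"
      using I d x' y unfolding com_prelie_ideal_UCP_iff by blast+
    \<comment> \<open>Changing one factor at a time uses the absorption property on both
      sides.\<close>
    moreover have "?b x' y' - ?b x y = ?b x' (y' - y) + ?b (x' - x) y"
      using bilinear_ext_add(2)[of basis_bullet x' "y' - y" y] bilinear_ext_add(1)[of basis_bullet "x' - x" x y]
      by simp
    ultimately show ?thesis
      using fin.subspace_add[OF subspace_I] by (simp add: coset_eq_iff)
  qed
  then have "(\<Union>x'\<in>I +>\<^bsub>UCP D\<^esub> x. \<Union>y'\<in>I +>\<^bsub>UCP D\<^esub> y. I +>\<^bsub>UCP D\<^esub> ?b x' y') =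
      (\<Union>x'\<in>I +>\<^bsub>UCP D\<^esub> x. \<Union>y'\<in>I +>\<^bsub>UCP D\<^esub> y. I +>\<^bsub>UCP D\<^esub> ?b x y)"
    by (intro SUP_cong refl)
  moreover have "x \<in> I +>\<^bsub>UCP D\<^esub> x" "y \<in> I +>\<^bsub>UCP D\<^esub> y"
    using fin.subspace_0[OF subspace_I] by (simp_all add: coset_mem)
  then have "I +>\<^bsub>UCP D\<^esub> x \<noteq> {}" "I +>\<^bsub>UCP D\<^esub> y \<noteq> {}" by blast+
  ultimately show ?thesis by (simp add: com_prelie_quot_def)
qed

lemma quot_simps:
  "add (com_prelie_quot (UCP D) I) = set_add (UCP D)"
  "zero (com_prelie_quot (UCP D) I) = I +>\<^bsub>UCP D\<^esub> 0"
  by (simp_all add: com_prelie_quot_def coset_zero)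

text \<open>The finite sums in \<open>family_basis\<close> are evaluated by rules that hold in
  commutative additive structures, so the quotient is first shown to be one.\<close>

lemma abelian_group_quot: "abelian_group (com_prelie_quot (UCP D) I)"
proof (rule abelian_groupI)
  fix x assume "x \<in> carrier (com_prelie_quot (UCP D) I)"
  then obtain p where p: "x = I +>\<^bsub>UCP D\<^esub> p" "p \<in> carrier (UCP D)" unfolding carrier_quot by blast
  then have "I +>\<^bsub>UCP D\<^esub> (- p) \<in> carrier (com_prelie_quot (UCP D) I)"
    unfolding carrier_quot using UCP_closed(3) by blast
  moreover have "(I +>\<^bsub>UCP D\<^esub> (- p)) \<oplus>\<^bsub>com_prelie_quot (UCP D) I\<^esub> x = \<zero>\<^bsub>com_prelie_quot (UCP D) I\<^esub>"
    by (simp only: p quot_simps coset_add) simp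
  ultimately show "\<exists>y\<in>carrier (com_prelie_quot (UCP D) I).
      y \<oplus>\<^bsub>com_prelie_quot (UCP D) I\<^esub> x = \<zero>\<^bsub>com_prelie_quot (UCP D) I\<^esub>" by blast
qed (auto simp del: UCP_simps simp: carrier_quot quot_simps coset_add UCP_closed ac_simps)

lemma finsum_quot:
  assumes "finite X" "g \<in> X \<rightarrow> carrier (UCP D)"
  shows "(\<Oplus>\<^bsub>com_prelie_quot (UCP D) I\<^esub>j\<in>X. I +>\<^bsub>UCP D\<^esub> g j) = I +>\<^bsub>UCP D\<^esub> (\<Sum>j\<in>X. g j)"
proof -
  interpret Q: abelian_group "com_prelie_quot (UCP D) I" by (rule abelian_group_quot)
  from assms show ?thesis
  proof (induction X rule: finite_induct)
    case empty
    then show ?case by (simp add: quot_simps)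
  next
    case (insert x X)
    have "(\<lambda>j. I +>\<^bsub>UCP D\<^esub> g j) \<in> X \<rightarrow> carrier (com_prelie_quot (UCP D) I)"
      "I +>\<^bsub>UCP D\<^esub> g x \<in> carrier (com_prelie_quot (UCP D) I)"
      unfolding carrier_quot using insert.prems by auto
    then show ?case
      using insert by (simp del: UCP_simps add: quot_simps coset_add)
  qed
qed

end

section \<open>Coordinates of \<open>f\<close>, and the theorem\<close>

lemma V0_subset: "V0 D \<subseteq> fin.span (tau 0 ` D)"
proof -
  have "tau 0 ` D \<subseteq> carrier (UCP D)"
    unfolding carrier_UCP tau_def
    by (intro image_subsetI fin.span_base imageI iso_class_UPT dtree_one_vertex) simp
  then have "fin.span (tau 0 ` D) \<subseteq> carrier (UCP D)"
    unfolding carrier_UCP by (intro fin.span_minimal fin.subspace_span)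
  then have "submodule (fin.span (tau 0 ` D)) base_field (UCP D)"
    by (simp only: submodule_UCP_iff fin.subspace_span simp_thms)
  then show ?thesis
    unfolding V0_def subspace_span_def by (intro Inter_lower) (auto intro: fin.span_base)
qed

text \<open>The source of the coordinate vectors \<open>a d\<close>; existence is enough, and no
  uniqueness is claimed.\<close>

lemma span_image_bas:
  assumes "x \<in> fin.span (g ` D)"
  shows "\<exists>q. Poly_Mapping.keys q \<subseteq> D \<and> x = lin g q"
  using assms
proof (induction rule: fin.span_induct_alt)
  case base
  show ?case by (intro exI[of _ 0]) simp
next
  case (step c x y)
  then obtain q d where "Poly_Mapping.keys q \<subseteq> D" "y = lin g q" "x = g d" "d \<in> D" by blast
  then show ?case
    using Poly_Mapping.keys_add[of "Poly_Mapping.single d c" q]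
    by (intro exI[of _ "Poly_Mapping.single d c + q"]) (auto simp: lin_add split: if_splits)
qed

theorem proposition3p5:
  fixes D :: "'d set"
    and f :: "('d, 'k::field_char_0) ucp \<Rightarrow> ('d, 'k) ucp"
  assumes "linear_endo_on base_field (UCP D) (V0 D) f"
  shows "family_basis base_field (com_prelie_quot (UCP D) (I_f D f)) (UPT' D)
           (\<lambda>T. I_f D f +>\<^bsub>UCP D\<^esub> bas T) \<and>
         (\<forall>d\<in>D.
           (I_f D f +>\<^bsub>UCP D\<^esub> tau 0 d)
             \<bullet>\<^bsub>com_prelie_quot (UCP D) (I_f D f)\<^esub> (I_f D f +>\<^bsub>UCP D\<^esub> bas (iso_class empty_forest))
           = I_f D f +>\<^bsub>UCP D\<^esub> f (tau 0 d))"
proof -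
  have "\<exists>q. Poly_Mapping.keys q \<subseteq> D \<and> f (tau 0 d) = lin (tau 0) q" if "d \<in> D" for d
  proof (rule span_image_bas)
    have "tau 0 d \<in> V0 D" using that by (auto simp: V0_def subspace_span_def)
    then show "f (tau 0 d) \<in> fin.span (tau 0 ` D)"
      using assms V0_subset[of D] by (auto simp: linear_endo_on_def)
  qed
  \<comment> \<open>A simultaneous choice of coordinates; from here on \<open>f\<close> is
    represented by \<open>a\<close>.\<close>
  then obtain a where a: "\<And>d. d \<in> D \<Longrightarrow> Poly_Mapping.keys (a d) \<subseteq> D"
    and f: "\<And>d. d \<in> D \<Longrightarrow> f (tau 0 d) = lin (tau 0) (a d)" by metis
  let ?I = "I_f D f" and ?U = "UCP D :: ('k, ('d, 'k) ucp) com_prelie"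
  let ?Q = "com_prelie_quot ?U ?I"
  have "{tau 1 d - f (tau 0 d) | d. d \<in> D} = {tau 1 d - lin (tau 0) (a d) | d. d \<in> D}"
    using f by (auto; metis)
  then have I_eq: "?I = fin.span (shift_relations D a)"
    unfolding I_f_def using ideal_gen_eq_span[OF a] by simp
  then have I: "com_prelie_ideal base_field ?U ?I"
    using com_prelie_ideal_shift_relations[OF a] by simp
  have bas: "bas T \<in> carrier ?U" if "T \<in> UPT D" for T
    unfolding carrier_UCP using that by (intro fin.span_base) auto
  have sum: "(\<Oplus>\<^bsub>?Q\<^esub>T\<in>X. c T \<odot>\<^bsub>?Q\<^esub> (?I +>\<^bsub>?U\<^esub> bas T)) = ?I +>\<^bsub>?U\<^esub> (\<Sum>T\<in>X. scal (c T) (bas T))"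
    if X: "finite X" "X \<subseteq> UPT' D" for X c
    unfolding quot_smult[OF I]
  proof (rule finsum_quot[OF I X(1)], rule Pi_I)
    fix T assume "T \<in> X"
    then show "scal (c T) (bas T) \<in> carrier ?U" using X(2) UPT'_subset[of D] by (intro UCP_closed(4) bas) auto
  qed
  have "family_basis base_field ?Q (UPT' D) (\<lambda>T. ?I +>\<^bsub>?U\<^esub> bas T)"
    unfolding family_basis_def
  proof (intro conjI allI impI ballI)
    show "(\<lambda>T. ?I +>\<^bsub>?U\<^esub> bas T) \<in> UPT' D \<rightarrow> carrier ?Q"
      unfolding carrier_quot[OF I] using bas UPT'_subset[of D] by blast
  next
    fix X and c :: "(nat \<times> 'd) ptree_class \<Rightarrow> 'k" and T
    assume X: "finite X \<and> X \<subseteq> UPT' D \<and> c \<in> X \<rightarrow> carrier base_field \<and>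
        (\<Oplus>\<^bsub>?Q\<^esub>T\<in>X. c T \<odot>\<^bsub>?Q\<^esub> (?I +>\<^bsub>?U\<^esub> bas T)) = \<zero>\<^bsub>?Q\<^esub>" and T: "T \<in> X"
    then have "?I +>\<^bsub>?U\<^esub> (\<Sum>T\<in>X. scal (c T) (bas T)) = ?I +>\<^bsub>?U\<^esub> 0"
      using sum[of X c] by (metis quot_simps(2)[OF I])
    then have "(\<Sum>T\<in>X. scal (c T) (bas T)) \<in> ?I"
      unfolding coset_eq_iff[OF I] by simp
    then have "c T = 0"
      unfolding I_eq using X T by (intro UPT'_independent[where X = X and a = a and D = D]) auto
    then show "c T = \<zero>\<^bsub>base_field\<^esub>" by (simp add: base_field_def)
  next
    fix x assume "x \<in> carrier ?Q"
    then obtain p where p: "x = ?I +>\<^bsub>?U\<^esub> p" "p \<in> carrier ?U" unfolding carrier_quot[OF I] by blast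
    have "bas ` UPT D \<subseteq> fin.span (bas ` UPT' D \<union> shift_relations D a)"
      using UPT'_spanning[of D a] a by (auto simp: UPT_iff)
    then have "p \<in> fin.span (bas ` UPT' D \<union> shift_relations D a)"
      by (rule subsetD[OF fin.span_minimal[OF _ fin.subspace_span] p(2)[unfolded carrier_UCP]])
    \<comment> \<open>The span of a union is the sum of the spans: \<open>z\<close> vanishes in the
      quotient, and the support of \<open>y\<close> provides the finite index set and the
      coefficients.\<close>
    then obtain y z where yz: "p = y + z" "y \<in> fin.span (bas ` UPT' D)" "z \<in> ?I"
      unfolding fin.span_Un I_eq by blast
    then have y: "Poly_Mapping.keys y \<subseteq> UPT' D" by (simp add: keys_subset_span)
    have "x = ?I +>\<^bsub>?U\<^esub> y" using yz p(1) by (simp add: coset_eq_iff[OF I])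
    also have "y = (\<Sum>T\<in>Poly_Mapping.keys y. scal (Poly_Mapping.lookup y T) (bas T))"
      by (rule lin_bas[unfolded lin_def, symmetric])
    also have "?I +>\<^bsub>?U\<^esub> \<dots> = (\<Oplus>\<^bsub>?Q\<^esub>T\<in>Poly_Mapping.keys y. Poly_Mapping.lookup y T \<odot>\<^bsub>?Q\<^esub> (?I +>\<^bsub>?U\<^esub> bas T))"
      using y by (intro sum[symmetric]) auto
    finally show "\<exists>X c. finite X \<and> X \<subseteq> UPT' D \<and> c \<in> X \<rightarrow> carrier base_field \<and>
        x = (\<Oplus>\<^bsub>?Q\<^esub>T\<in>X. c T \<odot>\<^bsub>?Q\<^esub> (?I +>\<^bsub>?U\<^esub> bas T))"
      using y by (intro exI[of _ "Poly_Mapping.keys y"] exI[of _ "Poly_Mapping.lookup y"])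
        (simp add: base_field_def)
  qed
  moreover have "(?I +>\<^bsub>?U\<^esub> tau 0 d) \<bullet>\<^bsub>?Q\<^esub> (?I +>\<^bsub>?U\<^esub> bas (iso_class empty_forest)) = ?I +>\<^bsub>?U\<^esub> f (tau 0 d)"
    if d: "d \<in> D" for d
  proof -
    have "iso_class empty_forest \<in> UPT D"
      by (rule iso_class_UPT) (simp add: dtree_def partitioned_tree_empty_forest, simp add: empty_forest_def)
    moreover have "iso_class (one_vertex (0, d)) \<in> UPT D"
      using d by (intro iso_class_UPT dtree_one_vertex) simp
    ultimately have "(?I +>\<^bsub>?U\<^esub> tau 0 d) \<bullet>\<^bsub>?Q\<^esub> (?I +>\<^bsub>?U\<^esub> bas (iso_class empty_forest)) =
        ?I +>\<^bsub>?U\<^esub> bilinear_ext basis_bullet (tau 0 d) (bas (iso_class empty_forest))"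
      unfolding tau_def by (intro quot_bullet[OF I] bas)
    also have "bilinear_ext basis_bullet (tau 0 d) (bas (iso_class empty_forest)) =
        (\<Sum>s\<in>verts (one_vertex (0::nat, d)). bas (iso_class (raise (one_vertex (0, d)) s)) :: ('d, 'k) ucp)"
      unfolding tau_def by (simp add: basis_bullet_empty partitioned_tree_one_vertex)
    also have "\<dots> = tau 1 d"
      by (simp add: raise_redec redec_one_vertex tau_def) (simp add: one_vertex_def)
    \<comment> \<open>The difference of the two representatives is one of the generators of the
      ideal.\<close>
    also have "?I +>\<^bsub>?U\<^esub> tau 1 d = ?I +>\<^bsub>?U\<^esub> f (tau 0 d)"
      unfolding coset_eq_iff[OF I] using d by (auto simp: I_f_def com_prelie_ideal_gen_def)
    finally show ?thesis .
  qed
  ultimately show ?thesis by blast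
qed

end
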